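(* There is an absolute constant $C>0$ (independent of $d$, $m$, $\epsilon$, the vectors $u_i$ and the coefficients $t_i$) such that the following holds. Let $\epsilon>0$, let $u_1,\ldots,u_m$ be column vectors in $\mathbb{C}^d$ such that $\sum_{i=1}^m u_iu_i^*\leq I$ and $\|u_i\|^2\leq\epsilon$ for all $i$, and suppose $0\leq t_i\leq 1$ for $1\leq i\leq m$. Then there is a set of indices $S\subseteq\{1,\ldots,m\}$ such that $$\left\|\sum_{i\in S}u_iu_i^*-\sum_{i=1}^m t_iu_iu_i^*\right\|\leq C\,\epsilon^{1/8}.$$
   Context: For a vector $u\in\mathbb{C}^d$, $\|u\|$ is the euclidean norm and $uu^*$ is the $d\times d$ positive matrix of rank at most one. For matrices, $\|\cdot\|$ is the operator norm on $M_d(\mathbb{C})$, $I$ is the identity matrix, and $A\leq B$ means that $B-A$ is positive semidefinite. The paper writes the conclusion as $O(\epsilon^{1/8})$, where the implied constant is absolute. *)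

theory Defs
  imports
    "HOL-Analysis.L2_Norm"
    "Jordan_Normal_Form.Schur_Decomposition"
begin

text \<open>
  Vectors and matrices carry their dimensions at the term level, because the constant in the
  theorem must not depend on the dimension: with dimensions encoded as types, no
  existential quantifier could stand outside the quantification over the dimension.
\<close>

definition euclid_norm :: "complex vec \<Rightarrow> real" where
  "euclid_norm v = L2_set (\<lambda>i. cmod (v $ i)) {..<dim_vec v}"

definition op_norm :: "complex mat \<Rightarrow> real" where
  "op_norm A = (SUP v \<in> {v \<in> carrier_vec (dim_col A). euclid_norm v \<le> 1}. euclid_norm (A *\<^sub>v v))"

definition rank_one :: "complex vec \<Rightarrow> complex mat" where
  "rank_one u = mat (dim_vec u) (dim_vec u) (\<lambda>(i, j). u $ i * cnj (u $ j))"

text \<open>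
  The inequality below is in the order of \<open>Complex_Order\<close>: \<open>0 \<le> z\<close> says that
  \<open>z\<close> is real and nonnegative.
\<close>

definition pos_semidef :: "complex mat \<Rightarrow> bool" where
  "pos_semidef A \<longleftrightarrow> square_mat A \<and> mat_adjoint A = A \<and>
     (\<forall>v \<in> carrier_vec (dim_row A). 0 \<le> (A *\<^sub>v v) \<bullet>c v)"

text \<open>The equality of dimensions is needed because subtraction of matrices is total.\<close>

definition loewner_le :: "complex mat \<Rightarrow> complex mat \<Rightarrow> bool" where
  "loewner_le A B \<longleftrightarrow> dim_row A = dim_row B \<and> dim_col A = dim_col B \<and> pos_semidef (B - A)"

abbreviation mat_sum :: "nat \<Rightarrow> ('i \<Rightarrow> complex mat) \<Rightarrow> 'i set \<Rightarrow> complex mat" where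
  "mat_sum d \<equiv> finsum (module_mat TYPE(complex) d d)"

end

theory Submission
  imports Defs "HOL-Computational_Algebra.Fundamental_Theorem_Algebra"
begin

text \<open>
  The argument is that of Marcus, Spielman and Srivastava, applied to the polynomial
  \<open>det (x I + \<Sum> z\<^sub>k u\<^sub>k u\<^sub>k\<^sup>*) det (x I + \<Sum> w\<^sub>k u\<^sub>k u\<^sub>k\<^sup>*)\<close>. Index \<open>k\<close> lowers \<open>z\<^sub>k\<close> by 1 with probability
  \<open>t\<^sub>k\<close> and otherwise lowers \<open>w\<^sub>k\<close> by 1; started from \<open>z = t\<close> and \<open>w = 1 - t\<close>, the two factors then
  control the discrepancy from both sides, because their matrices have opposite sums. The expected
  polynomial has no zeros \<open>x \<ge> 2 \<surd>\<epsilon> + \<epsilon>\<close> (barrier argument), and one index after the other can be fixed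
  without losing this (interlacing), which gives the bound \<open>2 \<surd>\<epsilon> + \<epsilon>\<close>.

  All polynomials are affine in each variable other than \<open>x\<close>. Both the barrier argument and the
  interlacing argument only need that the barriers are nonnegative, decreasing and convex. This
  follows from the partial fractions of a rational function that maps the upper half-plane to
  the lower one: its poles are real and simple with positive residues.
\<close>

section \<open>Rational functions with imaginary part bounded above on the upper half-plane\<close>

text \<open>The weights enter both as probabilities and as starting point: on average index k lowers
  \<open>z (k, True)\<close> by \<open>t k\<close>, so the problem is centered, and for the chosen
  set S the two factors end at t - 1_S and 1_S - t. A factor without zeros from x = \<eta> on
  belongs to a Hermitian matrix with all eigenvalues above -\<eta>; for two opposite matrices this
  is a bound on the norm.

  Averaging acts as 1 - p \<partial>_a - (1 - p) \<partial>_b with a and b in different factors, so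
  convexity is needed in the mixed direction (p, 1 - p). Since this direction is nonnegative, a
  parameter from the upper half-plane keeps all coordinates in the closed upper half-plane, and
  partial fractions apply along the line as they do in x.

  The bound arises as follows. A barrier is u^* M^-1 u, at most \<epsilon> divided by the least
  eigenvalue of M. At the start this eigenvalue is at least x - \<surd>\<epsilon>, and x = 2
  \<surd>\<epsilon> + \<epsilon> is the value for which \<epsilon> / (x - \<surd>\<epsilon>) equals
  \<surd>\<epsilon> / (1 + \<surd>\<epsilon>), the largest barrier that steps of length 1 +
  \<surd>\<epsilon> admit.\<close>

lemma upper_half_plane_power_sign:
  fixes c :: complex
  assumes c: "c \<noteq> 0" and k: "k \<ge> 1"
    and le: "\<And>w. Im w > 0 \<Longrightarrow> Im (c / w ^ k) \<le> 0"
  shows "k = 1 \<and> Im c = 0 \<and> Re c > 0"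
proof -
  \<comment> \<open>With the argument in [0, 2\<pi>), the test angle \<phi> / (2 k) is below \<pi>
    for every k \<ge> 1; it leaves the argument \<phi> / 2, whose sine is positive unless \<phi> =
    0.\<close>
  obtain \<phi> where phi: "0 \<le> \<phi>" "\<phi> < 2 * pi" and c_eq: "c = of_real (cmod c) * cis \<phi>"
  proof (cases "Arg c \<ge> 0")
    case True
    have "c = of_real (cmod c) * cis (Arg c)"
      using rcis_cmod_Arg[of c] by (simp add: rcis_def)
    then show ?thesis using True Arg_bounded[of c] pi_gt_zero by (intro that[of "Arg c"]) linarith+
  next
    case False
    have "c = of_real (cmod c) * cis (Arg c + 2 * pi)"
      using rcis_cmod_Arg[of c] by (simp add: rcis_def flip: cis_mult)
    then show ?thesis using False Arg_bounded[of c] by (intro that[of "Arg c + 2 * pi"]) linarith+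
  qed
  have sin_le: "sin (\<phi> - k * \<theta>) \<le> 0" if "0 < \<theta>" "\<theta> < pi" for \<theta> :: real
  proof -
    have "c / cis \<theta> ^ k = of_real (cmod c) * cis (\<phi> - k * \<theta>)"
      by (subst c_eq) (simp add: DeMoivre flip: cis_divide)
    then have "cmod c * sin (\<phi> - k * \<theta>) \<le> 0"
      using le[of "cis \<theta>"] sin_gt_zero[OF that] by simp
    then show ?thesis using c by (simp add: mult_le_0_iff)
  qed
  have phi0: "\<phi> = 0"
  proof (rule ccontr)
    assume "\<phi> \<noteq> 0"
    then have pos: "0 < \<phi>" using phi by simp
    have "\<phi> / (2 * k) \<le> \<phi> / 2" using k pos by (intro divide_left_mono) auto
    then have "sin (\<phi> - k * (\<phi> / (2 * k))) \<le> 0"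
      using pos k phi by (intro sin_le) auto
    moreover have "\<phi> - k * (\<phi> / (2 * k)) = \<phi> / 2" using k by (simp add: field_simps)
    ultimately have "sin (\<phi> / 2) \<le> 0" by metis
    then show False using sin_gt_zero[of "\<phi> / 2"] pos phi by simp
  qed
  have "k = 1"
  proof (rule ccontr)
    assume "k \<noteq> 1"
    \<comment> \<open>As \<phi> = 0, the angle 3 \<pi> / (2 k) gives the sine of -3 \<pi> / 2, which
      is 1; the angle is below \<pi> because k \<ge> 2.\<close>
    then have k2: "real k \<ge> 2" using k by simp
    have "3 * pi / (2 * k) < pi" using k2 by (simp add: field_simps)
    then have "sin (\<phi> - k * (3 * pi / (2 * k))) \<le> 0" using k2 by (intro sin_le) auto
    moreover have "\<phi> - k * (3 * pi / (2 * k)) = - (3 / 2 * pi)" using k2 phi0 by (simp add: field_simps)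
    ultimately show False using sin_3over2_pi by simp
  qed
  moreover have "c = of_real (cmod c)" using c_eq phi0 by simp
  then have "Im c = 0" "Re c = cmod c" by (metis Im_complex_of_real, metis Re_complex_of_real)
  ultimately show ?thesis using c by simp
qed

lemma exists_complex_root:
  assumes "k \<ge> 1"
  shows "\<exists>w::complex. w ^ k = c"
proof -
  have "rcis (root k (cmod c)) (Arg c / k) ^ k = c"
    using assms by (simp add: DeMoivre2 real_root_pow_pos2 rcis_cmod_Arg)
  then show ?thesis ..
qed

lemma eventually_ray_notin_finite:
  fixes w r :: complex
  assumes "finite X" "w \<noteq> 0"
  shows "eventually (\<lambda>\<rho>. r + of_real \<rho> * w \<notin> X) (at_right 0)"
proof -
  have "((\<lambda>\<rho>. r + of_real \<rho> * w) \<longlongrightarrow> r + of_real 0 * w) (at_right 0)"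
    by (intro tendsto_intros)
  then have "filterlim (\<lambda>\<rho>. r + of_real \<rho> * w) (at r) (at_right 0)"
    unfolding filterlim_at using assms by (auto simp: eventually_at_filter)
  moreover have "eventually (\<lambda>z. z \<notin> X) (at r)"
  proof -
    have "open (- (X - {r}))" using assms by (intro open_Compl finite_imp_closed) auto
    then show ?thesis unfolding eventually_at_topological by blast
  qed
  ultimately show ?thesis by (rule eventually_compose_filterlim[rotated])
qed

text \<open>Multiplication by \<rho>^k removes the pole and sends the bound K to 0, so near a pole
  any upper bound on the imaginary part, however large, becomes a sign condition on the leading
  coefficient in direction w.\<close>

lemma pole_direction_sign:
  fixes N D E :: "complex poly"
  assumes D: "D = [:- r, 1:] ^ k * E" and k: "k \<ge> 1" and E: "poly E r \<noteq> 0" and w: "w \<noteq> 0"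
    and bound: "eventually (\<lambda>\<rho>. Im (poly N (r + of_real \<rho> * w) / poly D (r + of_real \<rho> * w)) \<le> K) (at_right 0)"
  shows "Im (poly N r / poly E r / w ^ k) \<le> 0"
proof (rule tendsto_le)
  let ?z = "\<lambda>\<rho>. r + of_real \<rho> * w"
  have z: "(?z \<longlongrightarrow> r + of_real 0 * w) (at_right 0)" by (intro tendsto_intros)
  have p: "((\<lambda>\<rho>. poly p (?z \<rho>)) \<longlongrightarrow> poly p r) (at_right 0)" for p
    using isCont_tendsto_compose[OF poly_isCont z, of p] by simp
  show "((\<lambda>\<rho>. Im (poly N (?z \<rho>) / poly E (?z \<rho>) / w ^ k)) \<longlongrightarrow> Im (poly N r / poly E r / w ^ k)) (at_right 0)"
    using E w by (intro tendsto_intros p) auto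
  have "((\<lambda>\<rho>. \<rho> ^ k * K) \<longlongrightarrow> 0 ^ k * K) (at_right 0)" by (intro tendsto_intros)
  then show "((\<lambda>\<rho>. \<rho> ^ k * K) \<longlongrightarrow> 0) (at_right 0)" using k by (cases k) auto
  have "eventually (\<lambda>\<rho>::real. \<rho> > 0) (at_right 0)" by (simp add: eventually_at_right_less)
  with bound show "eventually (\<lambda>\<rho>. Im (poly N (?z \<rho>) / poly E (?z \<rho>) / w ^ k) \<le> \<rho> ^ k * K) (at_right 0)"
  proof eventually_elim
    case (elim \<rho>)
    have "poly N (?z \<rho>) / poly E (?z \<rho>) / w ^ k
        = of_real (\<rho> ^ k) * (poly N (?z \<rho>) / poly D (?z \<rho>))"
      using elim w by (simp add: D poly_power power_mult_distrib)
    then have "Im (poly N (?z \<rho>) / poly E (?z \<rho>) / w ^ k)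
        = \<rho> ^ k * Im (poly N (?z \<rho>) / poly D (?z \<rho>))" by (simp only: Im_complex_of_real times_complex.simps) simp
    then show ?case using elim by (simp add: mult_left_mono)
  qed
qed simp

text \<open>The exceptional set absorbs the zeros of \<open>D\<close>, where the quotient is 0 by convention.\<close>

definition pick_bounded :: "complex poly \<Rightarrow> complex poly \<Rightarrow> bool" where
  "pick_bounded N D \<longleftrightarrow> (\<exists>K X. finite X \<and>
     (\<forall>z. z \<notin> X \<longrightarrow> Im z > 0 \<longrightarrow> Im (poly N z / poly D z) \<le> K) \<and>
     (\<forall>z. z \<notin> X \<longrightarrow> Im z < 0 \<longrightarrow> - K \<le> Im (poly N z / poly D z)))"

text \<open>At a pole off the real axis all directions w are admissible, and w^k takes every phase,
  which contradicts the sign condition. At a real pole the directions in the upper half-plane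
  remain, and they force order 1 and a positive residue.\<close>

lemma pick_bounded_pole:
  assumes pb: "pick_bounded N D" and D: "D \<noteq> 0" and r: "poly D r = 0" and N: "poly N r \<noteq> 0"
  obtains E where "D = [:- r, 1:] * E" "poly E r \<noteq> 0" "Im r = 0"
    "Im (poly N r / poly E r) = 0" "Re (poly N r / poly E r) > 0"
proof -
  define k where "k = Polynomial.order r D"
  obtain E where E: "D = [:- r, 1:] ^ k * E" "\<not> [:- r, 1:] dvd E"
    using order_decomp[OF D] unfolding k_def by blast
  have k1: "k \<ge> 1" using D r order_root[of D r] unfolding k_def by simp
  have Er: "poly E r \<noteq> 0" using E(2) by (simp add: poly_eq_0_iff_dvd)
  obtain K X where X: "finite X"
    and up: "\<And>z. z \<notin> X \<Longrightarrow> Im z > 0 \<Longrightarrow> Im (poly N z / poly D z) \<le> K"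
    and lo: "\<And>z. z \<notin> X \<Longrightarrow> Im z < 0 \<Longrightarrow> - K \<le> Im (poly N z / poly D z)"
    using pb unfolding pick_bounded_def by blast
  define c where "c = poly N r / poly E r"
  have c0: "c \<noteq> 0" using N Er by (simp add: c_def)
  have im: "((\<lambda>\<rho>. Im (r + of_real \<rho> * w)) \<longlongrightarrow> Im r) (at_right 0)" for w
  proof -
    have "((\<lambda>\<rho>. Im (r + of_real \<rho> * w)) \<longlongrightarrow> Im (r + of_real 0 * w)) (at_right 0)"
      by (intro tendsto_intros)
    then show ?thesis by simp
  qed
  have up_c: "Im (c / w ^ k) \<le> 0" if w: "w \<noteq> 0"
    and ev: "eventually (\<lambda>\<rho>. Im (r + of_real \<rho> * w) > 0) (at_right 0)" for w
    unfolding c_def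
  proof (rule pole_direction_sign[OF E(1) k1 Er w])
    show "eventually (\<lambda>\<rho>. Im (poly N (r + of_real \<rho> * w) / poly D (r + of_real \<rho> * w)) \<le> K) (at_right 0)"
      using ev eventually_ray_notin_finite[OF X w, of r] by eventually_elim (rule up)
  qed
  \<comment> \<open>This direction makes c / w^k equal to \<i>, the worst phase for the sign
    condition.\<close>
  obtain w where w: "w ^ k = - \<i> * c" using exists_complex_root[OF k1] by blast
  have w0: "w \<noteq> 0" using w c0 k1 by (auto simp: power_0_left)
  have cw: "c / w ^ k = \<i>" using w c0 by (simp add: field_simps)
  have "\<not> Im r > 0"
  proof
    assume "Im r > 0"
    then have "eventually (\<lambda>\<rho>. Im (r + of_real \<rho> * w) > 0) (at_right 0)"
      using im order_tendstoD(1) by blast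
    from up_c[OF w0 this] show False by (simp add: cw)
  qed
  moreover have "\<not> Im r < 0"
  proof
    assume "Im r < 0"
    obtain v where v: "v ^ k = \<i> * c" using exists_complex_root[OF k1] by blast
    have v0: "v \<noteq> 0" using v c0 k1 by (auto simp: power_0_left)
    have "eventually (\<lambda>\<rho>. Im (r + of_real \<rho> * v) < 0) (at_right 0)"
      using im order_tendstoD(2) \<open>Im r < 0\<close> by blast
    \<comment> \<open>Negating N turns the lower bound on the lower half-plane into an upper
      bound.\<close>
    then have "eventually (\<lambda>\<rho>. Im (poly (- N) (r + of_real \<rho> * v) / poly D (r + of_real \<rho> * v)) \<le> K) (at_right 0)"
      using eventually_ray_notin_finite[OF X v0, of r]
      by eventually_elim (use lo in fastforce)
    from pole_direction_sign[OF E(1) k1 Er v0 this]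
    have "Im (- c / v ^ k) \<le> 0" by (simp add: c_def)
    moreover have "- c / v ^ k = \<i>" using v c0 by (simp add: field_simps)
    ultimately show False by (metis imaginary_unit.sel(2) not_one_le_zero)
  qed
  ultimately have imr: "Im r = 0" by simp
  have "Im (c / w ^ k) \<le> 0" if w: "Im w > 0" for w
  proof (rule up_c)
    have "eventually (\<lambda>\<rho>::real. \<rho> > 0) (at_right 0)" by (simp add: eventually_at_right_less)
    then show "eventually (\<lambda>\<rho>. Im (r + of_real \<rho> * w) > 0) (at_right 0)"
      by eventually_elim (use imr w in simp)
  qed (use w in auto)
  from upper_half_plane_power_sign[OF c0 k1 this]
  have "k = 1" "Im c = 0" "Re c > 0" by auto
  then show ?thesis using E Er imr by (intro that[of E]) (auto simp: c_def)
qed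

lemma pick_bounded_cancel:
  assumes "pick_bounded ([:- r, 1:] * N) ([:- r, 1:] * D)"
  shows "pick_bounded N D"
proof -
  obtain K X where X: "finite X"
    and up: "\<And>z. z \<notin> X \<Longrightarrow> Im z > 0 \<Longrightarrow> Im (poly ([:- r, 1:] * N) z / poly ([:- r, 1:] * D) z) \<le> K"
    and lo: "\<And>z. z \<notin> X \<Longrightarrow> Im z < 0 \<Longrightarrow> - K \<le> Im (poly ([:- r, 1:] * N) z / poly ([:- r, 1:] * D) z)"
    using assms unfolding pick_bounded_def by blast
  have eq: "poly ([:- r, 1:] * N) z / poly ([:- r, 1:] * D) z = poly N z / poly D z" if "z \<noteq> r" for z
    unfolding poly_mult using that by simp
  show ?thesis unfolding pick_bounded_def
  proof (intro exI[of _ K] exI[of _ "insert r X"] conjI allI impI)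
    show "finite (insert r X)" using X by simp
  next
    fix z assume "z \<notin> insert r X" "Im z > 0"
    then show "Im (poly N z / poly D z) \<le> K" using up[of z] eq[of z] by simp
  next
    fix z assume "z \<notin> insert r X" "Im z < 0"
    then show "- K \<le> Im (poly N z / poly D z)" using lo[of z] eq[of z] by simp
  qed
qed

text \<open>Near r the remainder is continuous; away from r the subtracted term c / (z - r) is
  bounded. Subtracting a pole can raise the imaginary part on the upper half-plane, so a sign
  condition is not visibly inherited, whereas boundedness is. This is why
  \<open>pick_bounded\<close> has a constant K.\<close>

lemma pick_bounded_remove_pole:
  assumes pb: "pick_bounded N ([:- r, 1:] * E)" and E: "poly E r \<noteq> 0"
    and N1: "N - smult c E = [:- r, 1:] * N1"
  shows "pick_bounded N1 E"
proof -
  obtain K X where X: "finite X"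
    and up: "\<And>z. z \<notin> X \<Longrightarrow> Im z > 0 \<Longrightarrow> Im (poly N z / poly ([:- r, 1:] * E) z) \<le> K"
    and lo: "\<And>z. z \<notin> X \<Longrightarrow> Im z < 0 \<Longrightarrow> - K \<le> Im (poly N z / poly ([:- r, 1:] * E) z)"
    using pb unfolding pick_bounded_def by blast
  have "isCont (\<lambda>z. poly N1 z / poly E z) r"
    using E by (intro continuous_intros poly_isCont) auto
  from this[unfolded isCont_def LIM_def, rule_format, of 1] obtain e where e: "e > 0"
    and near': "\<forall>z. z \<noteq> r \<and> dist z r < e \<longrightarrow> dist (poly N1 z / poly E z) (poly N1 r / poly E r) < 1"
    by auto
  have near: "dist (poly N1 z / poly E z) (poly N1 r / poly E r) < 1" if "dist z r < e" for z
    using near' that by (cases "z = r") auto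
  define M where "M = cmod (poly N1 r / poly E r) + 1"
  have near_le: "\<bar>Im (poly N1 z / poly E z)\<bar> \<le> M" if "dist z r < e" for z
  proof -
    have "cmod (poly N1 z / poly E z) \<le> M"
      using near[OF that] norm_triangle_ineq2[of "poly N1 z / poly E z" "poly N1 r / poly E r"]
      unfolding M_def dist_norm by linarith
    then show ?thesis using abs_Im_le_cmod order_trans by blast
  qed
  define X' where "X' = insert r (X \<union> {z. poly E z = 0})"
  have "E \<noteq> 0" using E by auto
  then have finX': "finite X'" using X poly_roots_finite[of E] by (auto simp: X'_def)
  have far: "\<bar>Im (poly N1 z / poly E z) - Im (poly N z / poly ([:- r, 1:] * E) z)\<bar> \<le> cmod c / e"
    if "dist z r \<ge> e" "z \<notin> X'" for z
  proof -
    have nz: "z \<noteq> r" "poly E z \<noteq> 0" using that by (auto simp: X'_def)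
    have "poly N z = c * poly E z + (z - r) * poly N1 z"
      using arg_cong[OF N1, of "\<lambda>p. poly p z"] by (simp add: algebra_simps)
    then have "poly N z / poly ([:- r, 1:] * E) z = poly N1 z / poly E z + c / (z - r)"
      using nz by (simp add: field_simps)
    then have "\<bar>Im (poly N1 z / poly E z) - Im (poly N z / poly ([:- r, 1:] * E) z)\<bar> = \<bar>Im (c / (z - r))\<bar>"
      by simp
    also have "\<dots> \<le> cmod c / cmod (z - r)" using abs_Im_le_cmod[of "c / (z - r)"] by (simp add: norm_divide)
    also have "\<dots> \<le> cmod c / e" using that e by (intro frac_le) (auto simp: dist_norm)
    finally show ?thesis .
  qed
  define K' where "K' = max M (K + cmod c / e)"
  show ?thesis unfolding pick_bounded_def
  proof (intro exI[of _ K'] exI[of _ X'] conjI allI impI finX')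
    fix z assume z: "z \<notin> X'" "Im z > 0"
    show "Im (poly N1 z / poly E z) \<le> K'"
      using near_le[of z] far[of z] up[of z] z unfolding K'_def
      by (cases "dist z r < e") (auto simp: X'_def max_def)
  next
    fix z assume z: "z \<notin> X'" "Im z < 0"
    show "- K' \<le> Im (poly N1 z / poly E z)"
      using near_le[of z] far[of z] lo[of z] z unfolding K'_def
      by (cases "dist z r < e") (auto simp: X'_def max_def)
  qed
qed

text \<open>Along rays to infinity the leading term dominates and the bound K becomes negligible, so
  the leading term alone satisfies a sign condition; this leaves degree at most 1 with a negative
  slope.\<close>

lemma pick_bounded_polynomial:
  assumes pb: "pick_bounded N [:d:]" and d: "d \<noteq> 0"
  obtains a b where "b \<le> 0" "\<And>z. poly N z / d = a + of_real b * z"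
proof -
  define Q where "Q = smult (inverse d) N"
  have Q: "poly Q z = poly N z / d" for z by (simp add: Q_def field_simps)
  define n where "n = degree Q"
  show ?thesis
  proof (cases "n = 0")
    case True
    then obtain a where "Q = [:a:]" using degree_eq_zeroE unfolding n_def by blast
    then show ?thesis using Q by (intro that[of 0 a]) (auto simp flip: Q)
  next
    case False
    then have n1: "n \<ge> 1" by simp
    define c where "c = lead_coeff Q"
    have c0: "c \<noteq> 0" using n1 by (auto simp: c_def n_def)
    obtain K X where X: "finite X"
      and "\<And>z. z \<notin> X \<Longrightarrow> Im z > 0 \<Longrightarrow> Im (poly N z / poly [:d:] z) \<le> K"
      using pb unfolding pick_bounded_def by blast
    then have up: "\<And>z. z \<notin> X \<Longrightarrow> Im z > 0 \<Longrightarrow> Im (poly Q z) \<le> K" by (simp add: Q)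
    have "Im (c * w ^ n) \<le> 0" if w: "Im w > 0" for w
    proof (rule tendsto_le)
      have w0: "w \<noteq> 0" using w by auto
      have "filterlim (\<lambda>\<rho>. w * of_real \<rho>) at_infinity (at_top :: real filter)"
        using w0 by (intro tendsto_mult_filterlim_at_infinity[OF tendsto_const] filterlim_of_real_at_infinity)
      then have "filterlim (\<lambda>\<rho>. of_real \<rho> * w) at_infinity (at_top :: real filter)"
        by (simp add: mult.commute)
      then have "((\<lambda>\<rho>. poly Q (of_real \<rho> * w) / (of_real \<rho> * w) ^ n) \<longlongrightarrow> c) (at_top :: real filter)"
        unfolding c_def n_def by (rule filterlim_compose[OF poly_divide_tendsto_aux])
      then show "((\<lambda>\<rho>. Im (poly Q (of_real \<rho> * w) / (of_real \<rho> * w) ^ n * w ^ n)) \<longlongrightarrow> Im (c * w ^ n)) (at_top :: real filter)"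
        by (intro tendsto_intros)
      show "((\<lambda>\<rho>. K / \<rho> ^ n) \<longlongrightarrow> 0) (at_top :: real filter)"
        using n1 by (intro tendsto_divide_0[OF tendsto_const] filterlim_at_top_imp_at_infinity filterlim_pow_at_top filterlim_ident) auto
      have fin: "finite ((\<lambda>z. cmod z / cmod w) ` X)" using X by simp
      have "eventually (\<lambda>\<rho>. \<rho> \<notin> (\<lambda>z. cmod z / cmod w) ` X) (at_top :: real filter)"
      proof -
        obtain B where B: "\<And>x. x \<in> (\<lambda>z. cmod z / cmod w) ` X \<Longrightarrow> x \<le> B"
          using bdd_above_finite[OF fin] unfolding bdd_above_def by blast
        show ?thesis using eventually_gt_at_top[of B]
          by eventually_elim (use B in \<open>meson not_less\<close>)
      qed
      then show "eventually (\<lambda>\<rho>. Im (poly Q (of_real \<rho> * w) / (of_real \<rho> * w) ^ n * w ^ n) \<le> K / \<rho> ^ n) (at_top :: real filter)"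
        using eventually_gt_at_top[of 0]
      proof eventually_elim
        case (elim \<rho>)
        have "of_real \<rho> * w \<notin> X"
        proof
          assume "of_real \<rho> * w \<in> X"
          then have "cmod (of_real \<rho> * w) / cmod w \<in> (\<lambda>z. cmod z / cmod w) ` X" by blast
          then show False using elim w0 by (simp add: norm_mult)
        qed
        then have "Im (poly Q (of_real \<rho> * w)) \<le> K" using elim w by (intro up) auto
        moreover have "poly Q (of_real \<rho> * w) / (of_real \<rho> * w) ^ n * w ^ n = poly Q (of_real \<rho> * w) / of_real (\<rho> ^ n)"
          using w0 by (simp add: power_mult_distrib)
        then have "Im (poly Q (of_real \<rho> * w) / (of_real \<rho> * w) ^ n * w ^ n) = Im (poly Q (of_real \<rho> * w)) / \<rho> ^ n"
          by (simp only: Im_divide_of_real)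
        ultimately show ?case using elim by (simp add: divide_right_mono)
      qed
    qed simp
    \<comment> \<open>The map w to -1 / w preserves the upper half-plane and turns the monomial into
      a pole, so that the sign lemma for poles applies.\<close>
    then have neg: "Im ((c * (- 1) ^ n) / w ^ n) \<le> 0" if "Im w > 0" for w
    proof -
      have "Im (- 1 / w) = Im w / ((Re w)\<^sup>2 + (Im w)\<^sup>2)" by (simp add: Im_divide)
      then have "Im (- 1 / w) > 0" using that by (simp only:) (intro divide_pos_pos add_nonneg_pos, auto)
      moreover have "c * (- 1 / w) ^ n = (c * (- 1) ^ n) / w ^ n" by (simp only: power_divide times_divide_eq_right)
      ultimately show ?thesis using \<open>\<And>w. Im w > 0 \<Longrightarrow> Im (c * w ^ n) \<le> 0\<close>[of "- 1 / w"] by simp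
    qed
    have "n = 1 \<and> Im (c * (- 1) ^ n) = 0 \<and> Re (c * (- 1) ^ n) > 0"
      using c0 by (intro upper_half_plane_power_sign n1 neg) auto
    then have n: "n = 1" and c: "Im c = 0" "Re c < 0" by auto
    have "poly Q z = coeff Q 0 + c * z" for z
      using n unfolding poly_altdef n_def[symmetric] c_def by (simp add: n_def)
    moreover have "c = of_real (Re c)" using c by (simp add: complex_eq_iff)
    ultimately have "poly N z / d = coeff Q 0 + of_real (Re c) * z" for z using Q[of z] by metis
    then show ?thesis using c by (intro that[of "Re c" "coeff Q 0"]) auto
  qed
qed

text \<open>A zero of D is either shared with N and cancelled, or a real simple pole with positive
  residue that is split off; both cases lower the degree of D by one and preserve
  \<open>pick_bounded\<close>.\<close>

lemma pick_partial_fractions: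
  assumes "D \<noteq> 0" "pick_bounded N D"
  shows "\<exists>a b R c. finite R \<and> b \<le> 0 \<and> (\<forall>r\<in>R. c r \<ge> 0 \<and> poly D (of_real r) = 0) \<and>
    (\<forall>z. poly D z \<noteq> 0 \<longrightarrow> poly N z / poly D z = a + of_real b * z + (\<Sum>r\<in>R. of_real (c r) / (z - of_real r)))"
  using assms
proof (induction "degree D" arbitrary: N D)
  case 0
  then obtain d where d: "D = [:d:]" by (metis degree_eq_zeroE)
  then have "d \<noteq> 0" using 0 by auto
  then obtain a b where "b \<le> 0" "\<And>z. poly N z / d = a + of_real b * z"
    using pick_bounded_polynomial[of N d] 0 d by metis
  then show ?case using d by (intro exI[of _ a] exI[of _ b] exI[of _ "{}"]) auto
next
  case (Suc n)
  then have "\<not> constant (poly D)" by (subst constant_degree) simp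
  then obtain r where r: "poly D r = 0" using fundamental_theorem_of_algebra by blast
  show ?case
  proof (cases "poly N r = 0")
    case True
    then obtain N1 E where N: "N = [:- r, 1:] * N1" and D: "D = [:- r, 1:] * E"
      using r by (metis dvdE poly_eq_0_iff_dvd)
    have "E \<noteq> 0" using Suc.prems(1) D by auto
    have "pick_bounded N1 E" using Suc.prems(2) unfolding D N by (rule pick_bounded_cancel)
    moreover have "degree E = n" using Suc.hyps(2) D \<open>E \<noteq> 0\<close> by (simp add: degree_mult_eq del: mult_pCons_left)
    ultimately obtain a b R c where *: "finite R" "b \<le> 0" "\<forall>r\<in>R. c r \<ge> 0 \<and> poly E (of_real r) = 0"
      "\<And>z. poly E z \<noteq> 0 \<Longrightarrow> poly N1 z / poly E z = a + of_real b * z + (\<Sum>r\<in>R. of_real (c r) / (z - of_real r))"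
      using Suc.hyps(1)[of E N1] \<open>E \<noteq> 0\<close> by blast
    have "poly N z / poly D z = poly N1 z / poly E z" if "poly D z \<noteq> 0" for z
      using that unfolding N D poly_mult by simp
    then show ?thesis using * D
      by (intro exI[of _ a] exI[of _ b] exI[of _ R] exI[of _ c]) auto
  next
    case False
    obtain E where D: "D = [:- r, 1:] * E" and E: "poly E r \<noteq> 0" "Im r = 0"
      "Im (poly N r / poly E r) = 0" "Re (poly N r / poly E r) > 0"
      using pick_bounded_pole[OF Suc.prems(2,1) r False] .
    define x where "x = Re r"
    define cr where "cr = Re (poly N r / poly E r)"
    have rx: "r = of_real x" using E by (simp add: x_def complex_eq_iff)
    have cr: "poly N r / poly E r = of_real cr" using E by (simp add: cr_def complex_eq_iff)
    then have Nr: "poly N r = of_real cr * poly E r" using E by (simp add: field_simps)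
    then have "poly (N - smult (of_real cr) E) r = 0" by simp
    then obtain N1 where N1: "N - smult (of_real cr) E = [:- r, 1:] * N1"
      by (metis dvdE poly_eq_0_iff_dvd)
    have "E \<noteq> 0" using E by auto
    have "pick_bounded N1 E" using pick_bounded_remove_pole[OF _ E(1) N1] Suc.prems D by simp
    moreover have "degree E = n" using Suc.hyps(2) D \<open>E \<noteq> 0\<close> by (simp add: degree_mult_eq del: mult_pCons_left)
    ultimately obtain a b R c where *: "finite R" "b \<le> 0" "\<forall>r\<in>R. c r \<ge> 0 \<and> poly E (of_real r) = 0"
      "\<And>z. poly E z \<noteq> 0 \<Longrightarrow> poly N1 z / poly E z = a + of_real b * z + (\<Sum>r\<in>R. of_real (c r) / (z - of_real r))"
      using Suc.hyps(1)[of E N1] \<open>E \<noteq> 0\<close> by blast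
    \<comment> \<open>Poles of the remainder are zeros of E, and E does not vanish at r; so the new
      pole is not yet in the sum.\<close>
    have xR: "x \<notin> R" using *(3) E(1) rx by auto
    have "poly N z / poly D z = a + of_real b * z + (\<Sum>r\<in>insert x R. of_real ((c(x := cr)) r) / (z - of_real r))"
      if "poly D z \<noteq> 0" for z
    proof -
      have nz: "z \<noteq> r" "poly E z \<noteq> 0" using that D by auto
      have "poly N z = of_real cr * poly E z + (z - r) * poly N1 z"
        using arg_cong[OF N1, of "\<lambda>p. poly p z"] by (simp add: algebra_simps)
      then have "poly N z / poly D z = poly N1 z / poly E z + of_real cr / (z - r)"
        using nz by (simp add: D field_simps)
      also have "\<dots> = a + of_real b * z + ((\<Sum>r\<in>R. of_real (c r) / (z - of_real r)) + of_real cr / (z - r))"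
        using *(4)[OF nz(2)] by simp
      also have "(\<Sum>r\<in>R. of_real (c r) / (z - of_real r)) = (\<Sum>r\<in>R. complex_of_real ((c(x := cr)) r) / (z - of_real r))"
        using xR by (intro sum.cong) auto
      finally show ?thesis using xR *(1) rx by simp
    qed
    moreover have "\<forall>r\<in>insert x R. (c(x := cr)) r \<ge> 0 \<and> poly D (of_real r) = 0"
      using *(3) E(4) rx D by (auto simp: cr_def)
    ultimately show ?thesis using * 
      by (intro exI[of _ a] exI[of _ b] exI[of _ "insert x R"] exI[of _ "c(x := cr)"]) auto
  qed
qed


section \<open>Monotonicity and convexity on a real half-line\<close>

lemma divide_conv_cnj_Im: "Im (z / w) = Im (z * cnj w) / (cmod w)\<^sup>2"
  by (subst complex_div_cnj) (simp flip: of_real_power add: Im_divide_of_real)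

text \<open>To the right of all poles every term c / (t - r), and b t with b \<le> 0, is decreasing
  and convex. Convexity appears as the statement that the tangent at y stays below the graph at x;
  the derivative is a parameter because it is later computed by the quotient rule. Conjugation
  symmetry carries the sign condition to the lower half-plane.\<close>

lemma pick_real_line:
  fixes N D :: "complex poly" and s x y :: real
  assumes im: "\<And>z. Im z > 0 \<Longrightarrow> Im (poly N z * cnj (poly D z)) \<le> 0"
    and realN: "\<And>z. poly N (cnj z) = cnj (poly N z)"
    and realD: "\<And>z. poly D (cnj z) = cnj (poly D z)"
    and nz: "\<And>t. s \<le> t \<Longrightarrow> poly D (of_real t) \<noteq> 0"
    and g: "\<And>t. s \<le> t \<Longrightarrow> g t = Re (poly N (of_real t) / poly D (of_real t))"
    and xy: "s \<le> x" "x \<le> y"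
  shows "g y \<le> g x"
    and "x < y \<Longrightarrow> (g has_real_derivative g') (at y) \<Longrightarrow> g' \<le> 0 \<and> - g' * (y - x) \<le> g x - g y"
proof -
  have D0: "D \<noteq> 0" using nz[of s] by auto
  have "pick_bounded N D" unfolding pick_bounded_def
  proof (intro exI[of _ 0] exI[of _ "{}"] conjI allI impI)
    fix z assume "Im z > 0"
    then show "Im (poly N z / poly D z) \<le> 0"
      using im by (simp add: divide_conv_cnj_Im divide_le_0_iff del: Im_divide)
  next
    fix z assume "Im z < 0"
    then have "Im (poly N (cnj z) / poly D (cnj z)) \<le> 0"
      using im[of "cnj z"] by (simp add: divide_conv_cnj_Im divide_le_0_iff)
    moreover have "poly N (cnj z) / poly D (cnj z) = cnj (poly N z / poly D z)"
      by (simp add: realN realD)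
    ultimately show "- 0 \<le> Im (poly N z / poly D z)" by (simp only: cnj.sel)
  qed simp
  from pick_partial_fractions[OF D0 this] obtain a b R c where pf: "finite R \<and> b \<le> 0 \<and> (\<forall>r\<in>R. c r \<ge> 0 \<and> poly D (of_real r) = 0) \<and>
    (\<forall>z. poly D z \<noteq> 0 \<longrightarrow> poly N z / poly D z = a + of_real b * z + (\<Sum>r\<in>R. of_real (c r) / (z - of_real r)))"
    by (elim exE)
  have R: "finite R" and b: "b \<le> 0"
    and c: "\<And>r. r \<in> R \<Longrightarrow> c r \<ge> 0" and root: "\<And>r. r \<in> R \<Longrightarrow> poly D (of_real r) = 0"
    and eq: "\<And>z. poly D z \<noteq> 0 \<Longrightarrow> poly N z / poly D z = a + of_real b * z + (\<Sum>r\<in>R. of_real (c r) / (z - of_real r))"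
    using pf by auto
  \<comment> \<open>All poles are real zeros of D, and D has none from s on.\<close>
  have less: "r < s" if "r \<in> R" for r using root[OF that] nz[of r] by (cases "r < s") auto
  define h where "h t = Re a + b * t + (\<Sum>r\<in>R. c r / (t - r))" for t
  have gh: "g t = h t" if "s \<le> t" for t
  proof -
    have "(\<Sum>r\<in>R. of_real (c r) / (complex_of_real t - of_real r)) = of_real (\<Sum>r\<in>R. c r / (t - r))"
      by simp
    then show ?thesis using g[OF that] eq[OF nz[OF that]] by (simp add: h_def del: of_real_sum)
  qed
  have diff: "h x - h y = - b * (y - x) + (\<Sum>r\<in>R. c r * (1 / (x - r) - 1 / (y - r)))"
    by (simp add: h_def algebra_simps sum_subtractf)
  have recip: "1 / (x - r) - 1 / (y - r) \<ge> (y - x) * (1 / (y - r)\<^sup>2)" "1 / (y - r) \<le> 1 / (x - r)" if "r \<in> R" for r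
  proof -
    have pos: "x - r > 0" "y - r > 0" "x - r \<le> y - r" using less[OF that] xy by auto
    have "1 / (x - r) - 1 / (y - r) = (y - x) * (1 / ((x - r) * (y - r)))"
      using pos by (simp add: field_simps)
    moreover have "1 / (y - r)\<^sup>2 \<le> 1 / ((x - r) * (y - r))"
      using pos by (simp add: power2_eq_square frac_le mult_right_mono)
    ultimately show "1 / (x - r) - 1 / (y - r) \<ge> (y - x) * (1 / (y - r)\<^sup>2)"
      using xy mult_left_mono by fastforce
    show "1 / (y - r) \<le> 1 / (x - r)" using pos by (simp add: frac_le)
  qed
  have "0 \<le> h x - h y"
    unfolding diff using b c xy recip(2)
    by (intro add_nonneg_nonneg sum_nonneg mult_nonneg_nonneg) auto
  then show "g y \<le> g x" using gh xy by simp
  assume lt: "x < y" and der: "(g has_real_derivative g') (at y)"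
  have "(h has_real_derivative b + (\<Sum>r\<in>R. - (c r / (y - r)\<^sup>2))) (at y)"
    unfolding h_def using less[of y] xy
    by (auto intro!: derivative_eq_intros sum.cong simp: power2_eq_square)
  moreover have "(h has_real_derivative g') (at y)"
    by (rule has_field_derivative_transform_within_open[OF der, of "{s<..}"]) (use lt xy gh in auto)
  ultimately have g': "g' = b + (\<Sum>r\<in>R. - (c r / (y - r)\<^sup>2))" by (rule DERIV_unique[rotated])
  have "(\<Sum>r\<in>R. - (c r / (y - r)\<^sup>2)) \<le> 0" using c by (intro sum_nonpos) auto
  then have "g' \<le> 0" using g' b by simp
  moreover have "- g' * (y - x) \<le> h x - h y"
  proof -
    have "- g' * (y - x) = - b * (y - x) + (\<Sum>r\<in>R. c r * ((y - x) * (1 / (y - r)\<^sup>2)))"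
      by (simp add: g' sum_negf algebra_simps sum_distrib_left)
    also have "\<dots> \<le> h x - h y"
      unfolding diff using c recip(1) by (intro add_left_mono sum_mono mult_left_mono) auto
    finally show ?thesis .
  qed
  ultimately show "g' \<le> 0 \<and> - g' * (y - x) \<le> g x - g y" using gh xy by simp
qed

section \<open>Stable functions and their barriers\<close>

type_synonym 'a stable_fun = "complex \<Rightarrow> ('a \<Rightarrow> complex) \<Rightarrow> complex"

text \<open>
  Shifting \<open>z a\<close> by \<open>-1\<close> subtracts a rank-one matrix in the application. For functions affine in
  \<open>z a\<close> the difference \<open>pd a f\<close> is also the partial derivative.
\<close>

definition pd :: "'a \<Rightarrow> 'a stable_fun \<Rightarrow> 'a stable_fun" where
  "pd a f = (\<lambda>x z. f x z - f x (z(a := z a - 1)))"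

definition multiaffine :: "'a stable_fun \<Rightarrow> bool" where
  "multiaffine f \<longleftrightarrow> (\<forall>x z a w. f x (z(a := w)) = f x z + (w - z a) * pd a f x z)"

text \<open>
  Only \<open>x\<close> must lie in the open upper half-plane; allowing real \<open>z\<close> makes limit arguments in
  the style of Hurwitz unnecessary.
\<close>

definition stable :: "nat \<Rightarrow> 'a stable_fun \<Rightarrow> bool" where
  "stable n f \<longleftrightarrow> multiaffine f \<and>
     (\<forall>z. \<exists>q. degree q = n \<and> lead_coeff q = 1 \<and> (\<forall>x. f x z = poly q x)) \<and>
     (\<forall>x z. f (cnj x) (\<lambda>a. cnj (z a)) = cnj (f x z)) \<and>
     (\<forall>x z. Im x > 0 \<longrightarrow> (\<forall>a. Im (z a) \<ge> 0) \<longrightarrow> f x z \<noteq> 0)"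

definition rval :: "'a stable_fun \<Rightarrow> real \<Rightarrow> ('a \<Rightarrow> real) \<Rightarrow> real" where
  "rval f x z = Re (f (of_real x) (\<lambda>a. of_real (z a)))"

text \<open>Only a ray in x is mentioned; that increasing a coordinate of z preserves the property
  is a consequence of nonnegative barriers (\<open>above_upd\<close>).\<close>

definition above :: "'a stable_fun \<Rightarrow> real \<Rightarrow> ('a \<Rightarrow> real) \<Rightarrow> bool" where
  "above f x0 z \<longleftrightarrow> (\<forall>x\<ge>x0. rval f x z > 0)"

text \<open>For a multiaffine f this is the logarithmic derivative in z a. For the determinant of M
  it is u^* M^-1 u, where u is the vector with index a.\<close>

definition barrier :: "'a stable_fun \<Rightarrow> 'a \<Rightarrow> real \<Rightarrow> ('a \<Rightarrow> real) \<Rightarrow> real" where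
  "barrier f a x z = rval (pd a f) x z / rval f x z"

lemma multiaffineD: "multiaffine f \<Longrightarrow> f x (z(a := w)) = f x z + (w - z a) * pd a f x z"
  unfolding multiaffine_def by blast

section \<open>Functions affine in each variable\<close>

lemma pd_upd_same:
  assumes "multiaffine f"
  shows "pd a f x (z(a := w)) = pd a f x z"
proof -
  have "pd a f x (z(a := w)) = f x (z(a := w)) - f x (z(a := w - 1))" by (simp add: pd_def)
  then show ?thesis
    using multiaffineD[OF assms, of x z a w] multiaffineD[OF assms, of x z a "w - 1"]
    by (simp add: algebra_simps)
qed

lemma pd_commute: "a \<noteq> b \<Longrightarrow> pd a (pd b f) x z = pd b (pd a f) x z"
  by (simp add: pd_def fun_upd_twist)

lemma multiaffine_shift:
  assumes "multiaffine f"
  shows "multiaffine (\<lambda>x z. f x (z(a := z a - 1)))"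
  unfolding multiaffine_def
proof (intro allI)
  fix x z b w
  show "f x ((z(b := w))(a := (z(b := w)) a - 1)) = f x (z(a := z a - 1)) + (w - z b) * pd b (\<lambda>x z. f x (z(a := z a - 1))) x z"
  proof (cases "a = b")
    case True
    have "pd a (\<lambda>x z. f x (z(a := z a - 1))) x z = pd a f x (z(a := z a - 1))" by (simp add: pd_def)
    also have "\<dots> = pd a f x z" by (rule pd_upd_same[OF assms])
    finally have "pd b (\<lambda>x z. f x (z(a := z a - 1))) x z = pd a f x z" using True by simp
    moreover have "f x (z(b := w - 1)) = f x (z(b := z b - 1)) + (w - z b) * pd b f x z"
      by (simp only: multiaffineD[OF assms, of x z b "w - 1"] multiaffineD[OF assms, of x z b "z b - 1"])
        (simp add: algebra_simps)
    ultimately show ?thesis using True by simp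
  next
    case False
    then show ?thesis
      using multiaffineD[OF assms, of x "z(a := z a - 1)" b w] by (simp add: pd_def fun_upd_twist)
  qed
qed

lemma multiaffine_lincomb:
  assumes "multiaffine f" "multiaffine g"
  shows "multiaffine (\<lambda>x z. p * f x z + q * g x z)"
  unfolding multiaffine_def
proof (intro allI)
  fix x z a w
  have "pd a (\<lambda>x z. p * f x z + q * g x z) x z = p * pd a f x z + q * pd a g x z"
    by (simp add: pd_def algebra_simps)
  then show "p * f x (z(a := w)) + q * g x (z(a := w))
      = p * f x z + q * g x z + (w - z a) * pd a (\<lambda>x z. p * f x z + q * g x z) x z"
    by (simp only: multiaffineD[OF assms(1), of x z a w] multiaffineD[OF assms(2), of x z a w])
      (simp add: algebra_simps)
qed

lemma multiaffine_pd: "multiaffine f \<Longrightarrow> multiaffine (pd a f)"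
  using multiaffine_lincomb[OF _ multiaffine_shift, of f f 1 "-1"] by (simp add: pd_def)

lemma of_real_fun_upd: "(\<lambda>b. complex_of_real ((z(a := w)) b)) = (\<lambda>b. of_real (z b))(a := of_real w)"
  by auto

lemma rval_upd:
  assumes "multiaffine f"
  shows "rval f x (z(a := w)) = rval f x z + (w - z a) * rval (pd a f) x z"
  unfolding rval_def of_real_fun_upd multiaffineD[OF assms]
  by (simp flip: of_real_diff)

text \<open>The direction in which a random choice between a and b differentiates. The type is
  generic because the same line is used at real points and with a complex parameter.\<close>

definition line :: "'a \<Rightarrow> real \<Rightarrow> 'a \<Rightarrow> real \<Rightarrow> ('a \<Rightarrow> 'b) \<Rightarrow> 'b \<Rightarrow> 'a \<Rightarrow> 'b::real_algebra_1" where
  "line a p b q z t = z(a := z a + of_real p * t, b := z b + of_real q * t)"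

lemma multiaffine_line:
  assumes f: "multiaffine f" and ab: "a \<noteq> b"
  shows "f x (line a p b q z t) = poly [:f x z, of_real p * pd a f x z + of_real q * pd b f x z,
    of_real (p * q) * pd a (pd b f) x z:] t"
proof -
  have "f x (line a p b q z t) = f x (z(a := z a + of_real p * t)) + of_real q * t * pd b f x (z(a := z a + of_real p * t))"
    unfolding line_def using multiaffineD[OF f, of x "z(a := z a + of_real p * t)" b] ab by simp
  then show ?thesis
    by (simp add: multiaffineD[OF f] multiaffineD[OF multiaffine_pd[OF f]] algebra_simps)
qed

lemma multiaffine_line_deriv:
  assumes f: "multiaffine f" and ab: "a \<noteq> b"
  shows "((\<lambda>t. rval f x (line a p b q z t)) has_real_derivative
    p * rval (pd a f) x (line a p b q z t) + q * rval (pd b f) x (line a p b q z t)) (at t)"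
proof -
  let ?z = "\<lambda>a. complex_of_real (z a)"
  have cline: "(\<lambda>c. complex_of_real (line a p b q z t c)) = line a p b q ?z (of_real t)" for t
    by (auto simp: line_def)
  have pda: "pd a f (of_real x) (line a p b q ?z (of_real t))
      = pd a f (of_real x) ?z + of_real q * of_real t * pd a (pd b f) (of_real x) ?z"
    using ab by (simp add: line_def fun_upd_twist[OF ab] pd_upd_same[OF f] multiaffineD[OF multiaffine_pd[OF f]] pd_commute)
  have pdb: "pd b f (of_real x) (line a p b q ?z (of_real t))
      = pd b f (of_real x) ?z + of_real p * of_real t * pd a (pd b f) (of_real x) ?z"
    using ab by (simp add: line_def pd_upd_same[OF f] multiaffineD[OF multiaffine_pd[OF f]])
  define A B C where "A = Re (f (of_real x) ?z)"
    and "B = Re (of_real p * pd a f (of_real x) ?z + of_real q * pd b f (of_real x) ?z)"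
    and "C = Re (pd a (pd b f) (of_real x) ?z)"
  have "rval f x (line a p b q z t) = A + t * B + p * q * t\<^sup>2 * C" for t
    unfolding rval_def cline multiaffine_line[OF f ab]
    by (simp add: A_def B_def C_def power2_eq_square algebra_simps)
  moreover have "p * rval (pd a f) x (line a p b q z t) + q * rval (pd b f) x (line a p b q z t) = B + 2 * p * q * t * C"
    unfolding rval_def cline pda pdb by (simp add: B_def C_def algebra_simps)
  moreover have "((\<lambda>t. A + t * B + p * q * t\<^sup>2 * C) has_real_derivative B + 2 * p * q * t * C) (at t)"
    by (auto intro!: derivative_eq_intros)
  ultimately show ?thesis by simp
qed

section \<open>Sign conditions and barriers of a stable function\<close>

context
  fixes n :: nat and f :: "'a stable_fun"
  assumes st: "stable n f"
begin

lemma stable_multiaffine: "multiaffine f" using st unfolding stable_def by blast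

lemma stable_monic: obtains q where "degree q = n" "lead_coeff q = 1" "\<And>x. f x z = poly q x"
  using st unfolding stable_def by metis

lemma stable_cnj: "f (cnj x) (\<lambda>a. cnj (z a)) = cnj (f x z)" using st unfolding stable_def by blast

lemma stable_nonzero: "Im x > 0 \<Longrightarrow> (\<And>a. Im (z a) \<ge> 0) \<Longrightarrow> f x z \<noteq> 0" using st unfolding stable_def by blast

text \<open>Two monic polynomials of equal degree are subtracted. The drop in degree makes barriers
  vanish at infinity.\<close>

lemma stable_pd_poly:
  obtains q where "q = 0 \<or> degree q < n" "\<And>x. pd a f x z = poly q x"
proof -
  obtain q where q: "degree q = n" "lead_coeff q = 1" "\<And>x. f x z = poly q x" using stable_monic[of z] by blast
  obtain q' where q': "degree q' = n" "lead_coeff q' = 1" "\<And>x. f x (z(a := z a - 1)) = poly q' x" using stable_monic[of "z(a := z a - 1)"] by blast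
  have "coeff (q - q') n = 0" "degree (q - q') \<le> n" using q q' by (auto intro: degree_diff_le)
  then have "q - q' = 0 \<or> degree (q - q') < n" by (metis leading_coeff_0_iff le_neq_implies_less)
  then show ?thesis using q q' by (intro that[of "q - q'"]) (auto simp: pd_def)
qed

lemma stable_pd_cnj: "pd a f (cnj x) (\<lambda>a. cnj (z a)) = cnj (pd a f x z)"
proof -
  have "(\<lambda>b. cnj (z b))(a := cnj (z a) - 1) = (\<lambda>b. cnj ((z(a := z a - 1)) b))" by auto
  then have "f (cnj x) ((\<lambda>b. cnj (z b))(a := cnj (z a) - 1)) = cnj (f x (z(a := z a - 1)))"
    by (simp only: stable_cnj)
  then show ?thesis by (simp only: pd_def stable_cnj complex_cnj_diff)
qed

lemma stable_real: "f (of_real x) (\<lambda>a. of_real (z a)) = of_real (rval f x z)"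
proof -
  have "cnj (f (of_real x) (\<lambda>a. of_real (z a))) = f (of_real x) (\<lambda>a. of_real (z a))"
    using stable_cnj[of "of_real x" "\<lambda>a. of_real (z a)"] by simp
  then show ?thesis unfolding rval_def by (metis Reals_cnj_iff complex_is_Real_iff of_real_Re)
qed

lemma stable_pd_real: "pd a f (of_real x) (\<lambda>a. of_real (z a)) = of_real (rval (pd a f) x z)"
proof -
  have "cnj (pd a f (of_real x) (\<lambda>a. of_real (z a))) = pd a f (of_real x) (\<lambda>a. of_real (z a))"
    using stable_pd_cnj[of a "of_real x" "\<lambda>a. of_real (z a)"] by simp
  then show ?thesis unfolding rval_def by (metis Reals_cnj_iff complex_is_Real_iff of_real_Re)
qed

text \<open>
  In the variable \<open>z a\<close> the function is affine, and its zero \<open>-f / pd a f\<close> (relative to the given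
  point) must lie strictly below the real axis.
\<close>

lemma stable_pd_sign:
  assumes x: "Im x > 0" and z: "\<And>a. Im (z a) \<ge> 0"
  shows "Im (pd a f x z * cnj (f x z)) \<le> 0"
    and "Im (pd a f x z * cnj (f x z)) = 0 \<Longrightarrow> pd a f x z = 0"
proof -
  let ?d = "pd a f x z"
  have key: "Im (?d * cnj (f x z)) < 0" if d: "?d \<noteq> 0"
  proof (rule ccontr)
    assume neg: "\<not> Im (?d * cnj (f x z)) < 0"
    define t where "t = - f x z / ?d"
    have "Im t = Im (?d * cnj (f x z)) / (cmod ?d)\<^sup>2"
      unfolding t_def divide_conv_cnj_Im by simp
    then have "Im t \<ge> 0" using neg by simp
    then have "f x (z(a := z a + t)) \<noteq> 0" using x z by (intro stable_nonzero) auto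
    moreover have "f x (z(a := z a + t)) = f x z + t * ?d"
      using multiaffineD[OF stable_multiaffine] by simp
    ultimately show False using d by (simp add: t_def)
  qed
  show "Im (?d * cnj (f x z)) \<le> 0" using key by (cases "?d = 0") (auto simp del: times_complex.sel)
  show "Im (?d * cnj (f x z)) = 0 \<Longrightarrow> ?d = 0" using key by (cases "?d = 0") (auto simp del: times_complex.sel)
qed

text \<open>The weak inequality survives the limit from x + \<i> e to x. It is needed for real x,
  when a line in z is followed at a fixed x.\<close>

lemma stable_pd_sign_closed:
  assumes x: "Im x \<ge> 0" and z: "\<And>a. Im (z a) \<ge> 0"
  shows "Im (pd a f x z * cnj (f x z)) \<le> 0"
proof -
  obtain q where q: "\<And>x. f x z = poly q x" using stable_monic[of z] by metis
  obtain q' where q': "\<And>x. pd a f x z = poly q' x" using stable_pd_poly[of a z] by metis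
  have t: "((\<lambda>e. x + of_real e * \<i>) \<longlongrightarrow> x + of_real 0 * \<i>) (at_right 0)" by (intro tendsto_intros)
  have p: "((\<lambda>e. poly p (x + of_real e * \<i>)) \<longlongrightarrow> poly p x) (at_right 0)" for p
    using isCont_tendsto_compose[OF poly_isCont t, of p] by simp
  have "((\<lambda>e. Im (poly q' (x + of_real e * \<i>) * cnj (poly q (x + of_real e * \<i>)))) \<longlongrightarrow>
     Im (poly q' x * cnj (poly q x))) (at_right 0)"
    by (intro tendsto_intros p)
  moreover have "eventually (\<lambda>e. Im (poly q' (x + of_real e * \<i>) * cnj (poly q (x + of_real e * \<i>))) \<le> 0) (at_right 0)"
    using eventually_at_right_less[of "0::real"]
  proof eventually_elim
    case (elim e)
    then show ?case using stable_pd_sign(1)[of "x + of_real e * \<i>" z a] x z q q' by simp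
  qed
  ultimately have "Im (poly q' x * cnj (poly q x)) \<le> 0"
    by (rule tendsto_upperbound) simp
  then show ?thesis by (simp add: q q')
qed

lemma stable_eventually_pos: "eventually (\<lambda>x. rval f x z > 0) at_top"
proof -
  obtain q where q: "degree q = n" "lead_coeff q = 1" "\<And>x. f x (\<lambda>a. of_real (z a)) = poly q x"
    using stable_monic[of "\<lambda>a. of_real (z a)"] by blast
  have "((\<lambda>x::real. poly q (of_real x) / of_real x ^ degree q) \<longlongrightarrow> lead_coeff q) at_top"
    by (rule filterlim_compose[OF poly_divide_tendsto_aux filterlim_of_real_at_infinity])
  then have "((\<lambda>x::real. Re (poly q (of_real x) / of_real x ^ n)) \<longlongrightarrow> Re 1) at_top"
    unfolding q(2) unfolding q(1) by (rule tendsto_Re)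
  then have "eventually (\<lambda>x. Re (poly q (of_real x) / of_real x ^ n) > 0) at_top"
    by (rule order_tendstoD) simp
  then show ?thesis using eventually_gt_at_top[of 0]
  proof eventually_elim
    case (elim x)
    have "Re (poly q (of_real x) / of_real x ^ n) = Re (poly q (of_real x)) / x ^ n"
      unfolding of_real_power[symmetric] by (rule Re_divide_of_real)
    then show ?case using elim by (simp add: rval_def q zero_less_divide_iff)
  qed
qed

lemma stable_rval_cont: "isCont (\<lambda>x. rval f x z) x"
proof -
  obtain q where q: "\<And>x. f x (\<lambda>a. of_real (z a)) = poly q x" using stable_monic[of "\<lambda>a. of_real (z a)"] by metis
  show ?thesis unfolding rval_def q by (intro isCont_Re isCont_o2[OF _ poly_isCont] continuous_intros)
qed

lemma aboveI:
  assumes "\<And>x. x \<ge> x0 \<Longrightarrow> f (of_real x) (\<lambda>a. of_real (z a)) \<noteq> 0"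
  shows "above f x0 z"
  unfolding above_def
proof (intro allI impI)
  fix x assume x: "x0 \<le> x"
  obtain y where y: "y \<ge> x" "rval f y z > 0"
    using eventually_conj[OF stable_eventually_pos[of z] eventually_ge_at_top[of x]]
    by (auto simp: eventually_at_top_linorder)
  show "rval f x z > 0"
  proof (rule ccontr)
    assume "\<not> rval f x z > 0"
    then have "\<exists>t\<ge>x. t \<le> y \<and> rval f t z = 0"
      using y by (intro IVT[of "\<lambda>x. rval f x z"]) (auto intro: stable_rval_cont)
    then show False using assms x by (force simp: stable_real)
  qed
qed

lemma barrier_antitone:
  assumes ab: "above f x0 z" and xy: "x0 \<le> x" "x \<le> y"
  shows "barrier f a y z \<le> barrier f a x z"
proof -
  let ?z = "\<lambda>a. complex_of_real (z a)"
  obtain D where D: "\<And>x. f x ?z = poly D x" using stable_monic[of ?z] by metis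
  obtain N where N: "\<And>x. pd a f x ?z = poly N x" using stable_pd_poly[of a ?z] by metis
  show ?thesis
  proof (rule pick_real_line(1)[where N = N and D = D, OF _ _ _ _ _ xy])
    show "Im (poly N w * cnj (poly D w)) \<le> 0" if "Im w > 0" for w
      using stable_pd_sign(1)[OF that, of ?z a] by (simp add: N D del: times_complex.sel)
    show "poly N (cnj w) = cnj (poly N w)" for w using stable_pd_cnj[of a w ?z] by (simp add: N)
    show "poly D (cnj w) = cnj (poly D w)" for w using stable_cnj[of w ?z] by (simp add: D)
    show "poly D (of_real t) \<noteq> 0" if "x0 \<le> t" for t
      using ab that unfolding above_def by (force simp: stable_real simp flip: D)
    show "barrier f a t z = Re (poly N (of_real t) / poly D (of_real t))" for t
      by (simp add: barrier_def stable_real stable_pd_real flip: N D of_real_divide)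
  qed
qed

text \<open>A decreasing function with limit 0 at infinity is nonnegative.\<close>

lemma barrier_nonneg:
  assumes ab: "above f x0 z" and x: "x0 \<le> x"
  shows "barrier f a x z \<ge> 0"
proof -
  let ?z = "\<lambda>a. complex_of_real (z a)"
  obtain D where D: "degree D = n" "\<And>x. f x ?z = poly D x" using stable_monic[of ?z] by metis
  obtain N where N: "N = 0 \<or> degree N < n" "\<And>x. pd a f x ?z = poly N x" using stable_pd_poly[of a ?z] by metis
  have "((\<lambda>x. poly N x / poly D x) \<longlongrightarrow> 0) at_infinity"
    using N(1) D(1) by (auto intro: poly_divide_tendsto_0_at_infinity)
  then have "((\<lambda>t::real. poly N (of_real t) / poly D (of_real t)) \<longlongrightarrow> 0) at_top"
    by (rule filterlim_compose[OF _ filterlim_of_real_at_infinity])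
  then have "((\<lambda>t::real. Re (poly N (of_real t) / poly D (of_real t))) \<longlongrightarrow> Re 0) at_top"
    by (rule tendsto_Re)
  moreover have "Re (poly N (of_real t) / poly D (of_real t)) = barrier f a t z" for t
    by (simp add: barrier_def stable_real stable_pd_real flip: N(2) D(2) of_real_divide)
  ultimately have lim: "((\<lambda>t. barrier f a t z) \<longlongrightarrow> 0) at_top" by simp
  have "eventually (\<lambda>t. barrier f a t z \<le> barrier f a x z) at_top"
    using eventually_ge_at_top[of x] by eventually_elim (rule barrier_antitone[OF ab x])
  from tendsto_upperbound[OF lim this] show ?thesis by simp
qed

lemma rval_upd_barrier:
  assumes "above f x0 z" "x0 \<le> x"
  shows "rval f x (z(a := w)) = rval f x z * (1 + (w - z a) * barrier f a x z)"
proof -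
  have "rval f x z \<noteq> 0" using assms unfolding above_def by force
  then show ?thesis
    unfolding rval_upd[OF stable_multiaffine] barrier_def by (simp add: field_simps)
qed

lemma above_upd:
  assumes "above f x0 z" "w \<ge> z a"
  shows "above f x0 (z(a := w))"
  unfolding above_def
proof (intro allI impI)
  fix x assume x: "x0 \<le> x"
  have "rval f x z * (1 + (w - z a) * barrier f a x z) > 0"
    using assms x barrier_nonneg[OF assms(1) x, of a] unfolding above_def
    by (intro mult_pos_pos add_pos_nonneg mult_nonneg_nonneg) auto
  then show "rval f x (z(a := w)) > 0" by (simp add: rval_upd_barrier[OF assms(1) x])
qed

lemma above_line:
  assumes "above f x0 z" "p \<ge> 0" "q \<ge> 0" "t \<ge> 0" "a \<noteq> b"
  shows "above f x0 (line a p b q z t)"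
  unfolding line_def using assms by (intro above_upd) auto

text \<open>At fixed real x both f and its derivative are polynomials in the line parameter. A
  parameter in the upper half-plane moves coordinates upwards only, as p and q are nonnegative, so
  their quotient has imaginary part at most 0 there.\<close>

lemma barrier_line:
  assumes ab: "above f x0 z" and x: "x0 \<le> x" and pq: "p \<ge> 0" "q \<ge> 0" and neq: "a \<noteq> b"
    and st': "0 \<le> s" "s \<le> t"
  shows "barrier f c x (line a p b q z t) \<le> barrier f c x (line a p b q z s)"
    and "s < t \<Longrightarrow> ((\<lambda>t. barrier f c x (line a p b q z t)) has_real_derivative g') (at t) \<Longrightarrow>
      g' \<le> 0 \<and> - g' * (t - s) \<le> barrier f c x (line a p b q z s) - barrier f c x (line a p b q z t)"
proof -
  let ?z = "\<lambda>a. complex_of_real (z a)"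
  have cline: "(\<lambda>c. complex_of_real (line a p b q z t c)) = line a p b q ?z (of_real t)" for t
    by (auto simp: line_def)
  have cnjline: "line a p b q ?z (cnj w) = (\<lambda>c. cnj (line a p b q ?z w c))" for w
    by (auto simp: line_def)
  obtain D where D: "\<And>t. f (of_real x) (line a p b q ?z t) = poly D t"
    using multiaffine_line[OF stable_multiaffine neq] by metis
  obtain N where N: "\<And>t. pd c f (of_real x) (line a p b q ?z t) = poly N t"
    using multiaffine_line[OF multiaffine_pd[OF stable_multiaffine] neq] by metis
  have im: "Im (poly N w * cnj (poly D w)) \<le> 0" if "Im w > 0" for w
  proof -
    have "Im (line a p b q ?z w d) \<ge> 0" for d using pq that by (auto simp: line_def)
    then show ?thesis
      using stable_pd_sign_closed[of "of_real x" "line a p b q ?z w" c] by (simp add: N D del: times_complex.sel)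
  qed
  have cN: "poly N (cnj w) = cnj (poly N w)" for w
    using stable_pd_cnj[of c "of_real x" "line a p b q ?z w"] by (simp add: cnjline flip: N)
  have cD: "poly D (cnj w) = cnj (poly D w)" for w
    using stable_cnj[of "of_real x" "line a p b q ?z w"] by (simp add: cnjline flip: D)
  have nz: "poly D (of_real t) \<noteq> 0" if "0 \<le> t" for t
    using above_line[OF ab pq that neq] x unfolding above_def
    by (force simp: stable_real simp flip: D cline)
  have g: "barrier f c x (line a p b q z t) = Re (poly N (of_real t) / poly D (of_real t))" for t
    by (simp add: barrier_def stable_real stable_pd_real flip: N D of_real_divide cline)
  note * = pick_real_line[where N = N and D = D and g = "\<lambda>t. barrier f c x (line a p b q z t)", OF im cN cD nz g st']
  show "barrier f c x (line a p b q z t) \<le> barrier f c x (line a p b q z s)" by (rule *(1))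
  show "s < t \<Longrightarrow> ((\<lambda>t. barrier f c x (line a p b q z t)) has_real_derivative g') (at t) \<Longrightarrow>
      g' \<le> 0 \<and> - g' * (t - s) \<le> barrier f c x (line a p b q z s) - barrier f c x (line a p b q z t)"
    by (rule *(2))
qed

end

section \<open>Averages of two shifts\<close>

definition avg :: "real \<Rightarrow> 'a \<Rightarrow> 'a \<Rightarrow> 'a stable_fun \<Rightarrow> 'a stable_fun" where
  "avg p a b f = (\<lambda>x z. of_real p * f x (z(a := z a - 1)) + of_real (1 - p) * f x (z(b := z b - 1)))"

lemma avg_eq_pd: "avg p a b f x z = f x z - of_real p * pd a f x z - of_real (1 - p) * pd b f x z"
  by (simp add: avg_def pd_def algebra_simps)

text \<open>At a zero of the average, f equals p \<open>pd a f\<close> + (1 - p)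
  \<open>pd b f\<close>. After multiplication by the conjugate of f the left side is real and both
  terms on the right have imaginary part at most 0; the equality case of the sign condition makes
  both terms vanish, and f with them.\<close>

lemma stable_avg:
  assumes st: "stable n f" and p: "0 \<le> p" "p \<le> 1"
  shows "stable n (avg p a b f)"
  unfolding stable_def
proof (intro conjI allI impI)
  note f = stable_multiaffine[OF st]
  show "multiaffine (avg p a b f)"
    unfolding avg_def by (intro multiaffine_lincomb multiaffine_shift f)
next
  fix z :: "'a \<Rightarrow> complex"
  obtain q where q: "degree q = n" "lead_coeff q = 1" "\<And>x. f x (z(a := z a - 1)) = poly q x" using stable_monic[OF st, of "z(a := z a - 1)"] by blast
  obtain q' where q': "degree q' = n" "lead_coeff q' = 1" "\<And>x. f x (z(b := z b - 1)) = poly q' x" using stable_monic[OF st, of "z(b := z b - 1)"] by blast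
  let ?r = "smult (of_real p) q + smult (of_real (1 - p)) q'"
  have "coeff ?r n = 1" using q q' by (simp flip: of_real_add)
  moreover have "degree ?r \<le> n" using q q' by (intro degree_add_le) (auto intro: order_trans[OF degree_smult_le])
  ultimately have "degree ?r = n" "lead_coeff ?r = 1" using le_degree[of ?r n] by auto
  then show "\<exists>q. degree q = n \<and> lead_coeff q = 1 \<and> (\<forall>x. avg p a b f x z = poly q x)"
    using q q' by (intro exI[of _ ?r]) (auto simp: avg_def)
next
  fix x z
  show "avg p a b f (cnj x) (\<lambda>a. cnj (z a)) = cnj (avg p a b f x z)"
    by (simp add: avg_eq_pd stable_cnj[OF st] stable_pd_cnj[OF st])
next
  fix x and z :: "'a \<Rightarrow> complex" assume x: "Im x > 0" and z: "\<forall>a. 0 \<le> Im (z a)"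
  show "avg p a b f x z \<noteq> 0"
  proof
    assume "avg p a b f x z = 0"
    then have eq: "f x z = of_real p * pd a f x z + of_real (1 - p) * pd b f x z" by (simp add: avg_eq_pd algebra_simps)
    have sgn: "Im (pd c f x z * cnj (f x z)) \<le> 0" "Im (pd c f x z * cnj (f x z)) = 0 \<Longrightarrow> pd c f x z = 0" for c
      using stable_pd_sign[OF st x, of z c] z by blast+
    define A B where "A = Im (pd a f x z * cnj (f x z))" and "B = Im (pd b f x z * cnj (f x z))"
    have "f x z * cnj (f x z) = of_real p * (pd a f x z * cnj (f x z)) + of_real (1 - p) * (pd b f x z * cnj (f x z))"
      by (subst eq) (simp add: algebra_simps)
    then have "Im (f x z * cnj (f x z)) = p * A + (1 - p) * B"
      unfolding A_def B_def by simp
    then have "p * A + (1 - p) * B = 0" by (simp add: complex_mult_cnj)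
    moreover have "p * A \<le> 0" "(1 - p) * B \<le> 0" using sgn(1) p unfolding A_def B_def by (auto intro: mult_nonneg_nonpos simp del: times_complex.sel)
    ultimately have "p * A = 0" "(1 - p) * B = 0" by linarith+
    then have "of_real p * pd a f x z = 0" "of_real (1 - p) * pd b f x z = 0"
      using sgn(2)[of a] sgn(2)[of b] unfolding A_def B_def by (auto simp del: times_complex.sel)
    then have "f x z = 0" using eq by (simp only: add_0_left)
    then show False using stable_nonzero[OF st x, of z] z by blast
  qed
qed

section \<open>Averaging over random shifts\<close>

lemma rval_avg:
  "rval (avg p a b f) x z = p * rval f x (z(a := z a - 1)) + (1 - p) * rval f x (z(b := z b - 1))"
proof -
  have "(\<lambda>c. complex_of_real ((z(a := z a - 1)) c)) = (\<lambda>c. of_real (z c))(a := of_real (z a) - 1)" for a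
    by auto
  then show ?thesis unfolding rval_def avg_def by simp
qed

lemma rval_pd: "rval (pd a f) x z = rval f x z - rval f x (z(a := z a - 1))"
proof -
  have "(\<lambda>c. complex_of_real ((z(a := z a - 1)) c)) = (\<lambda>c. of_real (z c))(a := of_real (z a) - 1)" for a
    by auto
  then show ?thesis unfolding rval_def pd_def by simp
qed

lemma rval_avg_pd:
  "rval (avg p a b f) x z = rval f x z - p * rval (pd a f) x z - (1 - p) * rval (pd b f) x z"
  by (simp add: rval_avg rval_pd algebra_simps)

lemma rval_pd_avg:
  assumes "c \<noteq> a" "c \<noteq> b"
  shows "rval (pd c (avg p a b f)) x z
    = rval (pd c f) x z - p * rval (pd a (pd c f)) x z - (1 - p) * rval (pd b (pd c f)) x z"
  using assms by (simp add: rval_pd rval_avg fun_upd_twist algebra_simps)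

text \<open>
  Along the line the logarithmic derivative \<open>g\<close> of \<open>f\<close> in direction \<open>c\<close> becomes
  \<open>g - g' / (1 - \<Phi>)\<close>, where \<open>\<Phi>\<close> is the logarithmic derivative along the line. Convexity of \<open>g\<close> and
  \<open>1 - \<Phi> \<ge> 1 / \<delta>\<close> bound this at \<open>\<delta>\<close> by \<open>g 0\<close>.
\<close>

lemma barrier_step:
  assumes st: "stable n f" and neq: "a \<noteq> b" and p: "0 \<le> p" "p \<le> 1" and d: "\<delta> > 0"
    and ab: "above f x0 z" and bar: "barrier f a x0 z \<le> 1 - 1 / \<delta>" "barrier f b x0 z \<le> 1 - 1 / \<delta>"
  defines "z' \<equiv> line a p b (1 - p) z \<delta>"
  shows "above (avg p a b f) x0 z'"
    and "c \<noteq> a \<Longrightarrow> c \<noteq> b \<Longrightarrow> barrier (avg p a b f) c x0 z' \<le> barrier f c x0 z"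
proof -
  have line0: "line a p b (1 - p) z 0 = z" by (auto simp: line_def)
  have p': "0 \<le> 1 - p" using p by simp
  have ab': "above f x0 z'" unfolding z'_def using above_line[OF st ab _ _ _ neq] p d by simp
  have le: "barrier f c x z' \<le> 1 - 1 / \<delta>" if "x0 \<le> x" "c = a \<or> c = b" for c x
  proof -
    have "barrier f c x z' \<le> barrier f c x0 z'" by (rule barrier_antitone[OF st ab' order_refl that(1)])
    also have "\<dots> \<le> barrier f c x0 z"
      using barrier_line(1)[OF st ab order_refl p(1) p' neq order_refl, of \<delta> c] d unfolding z'_def line0 by simp
    also have "\<dots> \<le> 1 - 1 / \<delta>" using bar that(2) by auto
    finally show ?thesis .
  qed
  define \<Phi> where "\<Phi> x = p * barrier f a x z' + (1 - p) * barrier f b x z'" for x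
  have Phi: "\<Phi> x \<le> 1 - 1 / \<delta>" if "x0 \<le> x" for x
  proof -
    have "\<Phi> x \<le> p * (1 - 1 / \<delta>) + (1 - p) * (1 - 1 / \<delta>)"
      unfolding \<Phi>_def using le that p p' by (intro add_mono mult_left_mono) auto
    also have "\<dots> = 1 - 1 / \<delta>" by (simp only: distrib_right[symmetric]) simp
    finally show ?thesis .
  qed
  have F: "rval f x z' > 0" if "x0 \<le> x" for x using ab' that unfolding above_def by simp
  have avg: "rval (avg p a b f) x z' = rval f x z' * (1 - \<Phi> x)" if "x0 \<le> x" for x
    using F[OF that] by (simp add: rval_avg_pd \<Phi>_def barrier_def field_simps)
  have lt: "1 - \<Phi> x > 0" if "x0 \<le> x" for x
  proof -
    have "1 / \<delta> > 0" using d by simp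
    then show ?thesis using Phi[OF that] by linarith
  qed
  show "above (avg p a b f) x0 z'" unfolding above_def using avg F lt by simp
  assume c: "c \<noteq> a" "c \<noteq> b"
  define N where "N t = rval (pd c f) x0 (line a p b (1 - p) z t)" for t
  define D where "D t = rval f x0 (line a p b (1 - p) z t)" for t
  define N' where "N' = p * rval (pd a (pd c f)) x0 z' + (1 - p) * rval (pd b (pd c f)) x0 z'"
  define D' where "D' = p * rval (pd a f) x0 z' + (1 - p) * rval (pd b f) x0 z'"
  have N: "(N has_real_derivative N') (at \<delta>)"
    unfolding N_def N'_def z'_def using stable_multiaffine[OF st] neq
    by (intro multiaffine_line_deriv multiaffine_pd)
  have D: "(D has_real_derivative D') (at \<delta>)"
    unfolding D_def D'_def z'_def using stable_multiaffine[OF st] neq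
    by (intro multiaffine_line_deriv)
  have D0: "D \<delta> > 0" using F[of x0] by (simp add: D_def z'_def)
  define g' where "g' = (N' * D \<delta> - N \<delta> * D') / (D \<delta> * D \<delta>)"
  have "((\<lambda>t. N t / D t) has_real_derivative g') (at \<delta>)"
    unfolding g'_def using D0 by (intro DERIV_divide N D) auto
  then have "((\<lambda>t. barrier f c x0 (line a p b (1 - p) z t)) has_real_derivative g') (at \<delta>)"
    by (simp add: barrier_def N_def D_def)
  from barrier_line(2)[OF st ab order_refl p(1) p' neq order_refl _ d this] d
  have g': "g' \<le> 0" "- g' * \<delta> \<le> barrier f c x0 z - N \<delta> / D \<delta>"
    by (auto simp: line0 barrier_def N_def D_def)
  have Phi': "\<Phi> x0 = D' / D \<delta>"
    using D0 by (simp add: \<Phi>_def barrier_def D'_def D_def z'_def field_simps)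
  have "barrier (avg p a b f) c x0 z' = (N \<delta> - N') / (D \<delta> * (1 - \<Phi> x0))"
    unfolding barrier_def avg[OF order_refl] rval_pd_avg[OF c] N_def N'_def D_def
    by (simp add: z'_def diff_diff_eq)
  \<comment> \<open>By the quotient rule N' = g' D + (N / D) D', and D' = \<Phi> D, so 1 - \<Phi>
    cancels against N / D.\<close>
  also have "\<dots> = N \<delta> / D \<delta> - g' / (1 - \<Phi> x0)"
    using D0 lt[of x0] unfolding g'_def Phi' by (simp add: field_simps)
  also have "- g' / (1 - \<Phi> x0) \<le> - g' / (1 / \<delta>)"
    using g'(1) Phi[of x0] d lt[of x0] by (intro divide_left_mono) auto
  then have "N \<delta> / D \<delta> - g' / (1 - \<Phi> x0) \<le> N \<delta> / D \<delta> - g' * \<delta>" by simp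
  also have "\<dots> \<le> barrier f c x0 z" using g'(2) by simp
  finally show "barrier (avg p a b f) c x0 z' \<le> barrier f c x0 z" .
qed

text \<open>
  If the average is positive from \<open>x0\<close> on, then so is \<open>f\<close>: at a root of \<open>f\<close> beyond which \<open>f\<close> is
  positive, both shifts of \<open>f\<close> are at most \<open>f\<close>, because the barriers are nonnegative. A shift that
  is positive at \<open>x0\<close> has barrier below 1 there, hence on the whole ray.
\<close>

lemma interlacing_step:
  assumes st: "stable n f" and p: "0 \<le> p" "p \<le> 1" and av: "above (avg p a b f) x0 z"
  shows "above f x0 (z(a := z a - 1)) \<or> above f x0 (z(b := z b - 1))"
proof -
  have ab: "above f x0 z"
  proof (rule ccontr)
    assume "\<not> above f x0 z"
    then obtain x1 where x1: "x1 \<ge> x0" "f (of_real x1) (\<lambda>a. of_real (z a)) = 0"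
      using aboveI[OF st] by blast
    obtain q where q: "degree q = n" "lead_coeff q = 1" "\<And>x. f x (\<lambda>a. of_real (z a)) = poly q x"
      using stable_monic[OF st, of "\<lambda>a. of_real (z a)"] by blast
    define R where "R = {x::real. poly q (of_real x) = 0}"
    have "q \<noteq> 0" using q by auto
    then have "finite {w. poly q w = 0}" by (rule poly_roots_finite)
    moreover have "R \<subseteq> Re ` {w. poly q w = 0}" unfolding R_def by force
    ultimately have finR: "finite R" by (blast intro: finite_subset)
    define \<mu> where "\<mu> = Max R"
    have "x1 \<in> R" using x1 q by (simp add: R_def)
    then have lam: "\<mu> \<in> R" "x1 \<le> \<mu>" "\<And>r. r \<in> R \<Longrightarrow> r \<le> \<mu>"
      using finR by (auto simp: \<mu>_def intro: Max_in Max_ge)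
    have above: "above f x z" if "x > \<mu>" for x
      using lam(3) that by (intro aboveI[OF st]) (force simp: q R_def)
    \<comment> \<open>At \<mu> the barriers have denominator 0, so the shifts are compared to the
      right of \<mu> and the inequality is carried over by continuity.\<close>
    have le: "rval f \<mu> (z(c := z c - 1)) \<le> rval f \<mu> z" for c
    proof -
      have "((\<lambda>x. rval f x (z(c := z c - 1))) \<longlongrightarrow> rval f \<mu> (z(c := z c - 1))) (at_right \<mu>)"
        "((\<lambda>x. rval f x z) \<longlongrightarrow> rval f \<mu> z) (at_right \<mu>)"
        using stable_rval_cont[OF st] unfolding isCont_def by (auto intro: tendsto_mono[OF at_le])
      moreover have "eventually (\<lambda>x. rval f x (z(c := z c - 1)) \<le> rval f x z) (at_right \<mu>)"
        using eventually_at_right_less[of \<mu>]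
      proof eventually_elim
        case (elim x)
        have "rval f x z > 0" using above[OF elim] unfolding above_def by simp
        then show ?case using barrier_nonneg[OF st above[OF elim] order_refl, of c]
          by (simp add: barrier_def rval_pd zero_le_divide_iff)
      qed
      ultimately show ?thesis by (intro tendsto_le[of "at_right \<mu>"]) auto
    qed
    have 0: "rval f \<mu> z = 0" using lam(1) by (simp add: R_def rval_def q)
    have "p * rval f \<mu> (z(a := z a - 1)) \<le> 0" "(1 - p) * rval f \<mu> (z(b := z b - 1)) \<le> 0"
      using le[of a] le[of b] p unfolding 0 by (auto intro: mult_nonneg_nonpos)
    moreover have "rval (avg p a b f) \<mu> z > 0" using av lam(2) x1(1) unfolding above_def by simp
    ultimately show False by (simp add: rval_avg)
  qed
  have pos: "above f x0 (z(c := z c - 1))" if c: "rval f x0 (z(c := z c - 1)) > 0" for c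
    unfolding above_def
  proof (intro allI impI)
    fix x assume x: "x0 \<le> x"
    have F: "rval f x0 z > 0" "rval f x z > 0" using ab x unfolding above_def by auto
    have "rval f x0 z * (1 - barrier f c x0 z) > 0"
      using c rval_upd_barrier[OF st ab order_refl, of c "z c - 1"] by simp
    then have "barrier f c x0 z < 1" using F by (simp add: zero_less_mult_iff)
    then have "barrier f c x z < 1" using barrier_antitone[OF st ab order_refl x, of c] by simp
    then have "rval f x z * (1 - barrier f c x z) > 0" using F by simp
    then show "rval f x (z(c := z c - 1)) > 0"
      using rval_upd_barrier[OF st ab x, of c "z c - 1"] by simp
  qed
  have "rval (avg p a b f) x0 z > 0" using av unfolding above_def by simp
  then have "rval f x0 (z(a := z a - 1)) > 0 \<or> rval f x0 (z(b := z b - 1)) > 0"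
    unfolding rval_avg using p
    by (smt (verit) mult_nonneg_nonpos)
  then show ?thesis using pos by blast
qed

text \<open>The head of the list is averaged first and the last element is outermost: barrier steps
  proceed from the front, choices are made from the back.\<close>

definition avgs :: "('i \<Rightarrow> real) \<Rightarrow> 'i list \<Rightarrow> ('i \<times> bool) stable_fun \<Rightarrow> ('i \<times> bool) stable_fun" where
  "avgs t js = fold (\<lambda>j. avg (t j) (j, True) (j, False)) js"

lemma stable_avgs:
  assumes "stable n f" "\<And>j. j \<in> set js \<Longrightarrow> 0 \<le> t j \<and> t j \<le> 1"
  shows "stable n (avgs t js f)"
  using assms unfolding avgs_def by (induction js arbitrary: f) (auto intro: stable_avg)

text \<open>A barrier step does not increase the barriers of the other indices; since the list is
  distinct, the indices still to come keep the bound that their own steps require.\<close>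

lemma above_avgs:
  assumes "stable n f" "distinct js" "\<And>j. j \<in> set js \<Longrightarrow> 0 \<le> t j \<and> t j \<le> 1" "\<delta> > 0" "above f x0 z"
    and "\<And>j s. j \<in> set js \<Longrightarrow> barrier f (j, s) x0 z \<le> 1 - 1 / \<delta>"
  shows "above (avgs t js f) x0
    (\<lambda>(j, s). if j \<in> set js then z (j, s) + (if s then t j else 1 - t j) * \<delta> else z (j, s))"
  using assms
proof (induction js arbitrary: f z)
  case Nil
  then show ?case by (simp add: avgs_def)
next
  case (Cons i js)
  define g where "g = avg (t i) (i, True) (i, False) f"
  define z' where "z' = line (i, True) (t i) (i, False) (1 - t i) z \<delta>"
  have ti: "0 \<le> t i" "t i \<le> 1" using Cons.prems(3)[of i] by auto
  have neq: "(i, True) \<noteq> (i, False)" by simp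
  have bars: "barrier f (i, True) x0 z \<le> 1 - 1 / \<delta>" "barrier f (i, False) x0 z \<le> 1 - 1 / \<delta>"
    using Cons.prems(6)[of i] by auto
  note step = barrier_step[OF Cons.prems(1) neq ti \<open>\<delta> > 0\<close> Cons.prems(5) bars]
  have ab: "above g x0 z'" unfolding g_def z'_def using step(1) by simp
  have bar: "barrier g (j, s) x0 z' \<le> 1 - 1 / \<delta>" if "j \<in> set js" for j s
  proof -
    have "j \<noteq> i" using that Cons.prems(2) by auto
    then have "barrier g (j, s) x0 z' \<le> barrier f (j, s) x0 z" unfolding g_def z'_def by (intro step(2)) auto
    then show ?thesis using Cons.prems(6)[of j s] that by simp
  qed
  have "above (avgs t js g) x0
    (\<lambda>(j, s). if j \<in> set js then z' (j, s) + (if s then t j else 1 - t j) * \<delta> else z' (j, s))"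
    using Cons.prems ab bar stable_avg[OF Cons.prems(1) ti] by (intro Cons.IH) (auto simp: g_def)
  moreover have "(\<lambda>(j, s). if j \<in> set js then z' (j, s) + (if s then t j else 1 - t j) * \<delta> else z' (j, s))
    = (\<lambda>(j, s). if j \<in> set (i # js) then z (j, s) + (if s then t j else 1 - t j) * \<delta> else z (j, s))"
    using Cons.prems(2) by (auto simp: z'_def line_def fun_eq_iff)
  ultimately show ?case by (simp add: avgs_def g_def)
qed

text \<open>The inner averages form a stable function, so the interlacing step applies to the
  outermost average; the shift it selects is absorbed into z before the next one is opened.\<close>

lemma above_choice:
  assumes "stable n f" "distinct js" "\<And>j. j \<in> set js \<Longrightarrow> 0 \<le> t j \<and> t j \<le> 1" "above (avgs t js f) x0 z"
  shows "\<exists>\<sigma>. above f x0 (\<lambda>(j, s). if j \<in> set js \<and> \<sigma> j = s then z (j, s) - 1 else z (j, s))"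
  using assms
proof (induction js arbitrary: z rule: rev_induct)
  case Nil
  then show ?case by (simp add: avgs_def)
next
  case (snoc i js)
  have ti: "0 \<le> t i" "t i \<le> 1" using snoc.prems(3)[of i] by auto
  have st: "stable n (avgs t js f)" using snoc.prems by (intro stable_avgs) auto
  have "above (avg (t i) (i, True) (i, False) (avgs t js f)) x0 z"
    using snoc.prems(4) by (simp add: avgs_def)
  from interlacing_step[OF st ti this] obtain s where s: "above (avgs t js f) x0 (z((i, s) := z (i, s) - 1))"
    by blast
  define z' where "z' = z((i, s) := z (i, s) - 1)"
  have "\<exists>\<sigma>. above f x0 (\<lambda>(j, s). if j \<in> set js \<and> \<sigma> j = s then z' (j, s) - 1 else z' (j, s))"
    by (rule snoc.IH) (use snoc.prems s in \<open>auto simp: z'_def fun_upd_def\<close>)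
  then obtain \<sigma> where \<sigma>: "above f x0 (\<lambda>(j, s). if j \<in> set js \<and> \<sigma> j = s then z' (j, s) - 1 else z' (j, s))" ..
  have eq: "(\<lambda>(j, s). if j \<in> set js \<and> \<sigma> j = s then z' (j, s) - 1 else z' (j, s))
    = (\<lambda>(j, s'). if j \<in> set (js @ [i]) \<and> (\<sigma>(i := s)) j = s' then z (j, s') - 1 else z (j, s'))"
    using snoc.prems(2) by (auto simp: z'_def fun_eq_iff)
  from \<sigma>[unfolded eq] show ?case by blast
qed

section \<open>Sums of rank-one matrices\<close>

abbreviation sq_norm :: "complex vec \<Rightarrow> real" where
  "sq_norm v \<equiv> (euclid_norm v)\<^sup>2"

text \<open>Defined by entries, so that the coefficients occur in ordinary sums;
  \<open>mat_sum_rank_one\<close> gives the link to sums in the module of matrices.\<close>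

definition pencil :: "nat \<Rightarrow> 'i set \<Rightarrow> ('i \<Rightarrow> complex vec) \<Rightarrow> complex \<Rightarrow> ('i \<Rightarrow> complex) \<Rightarrow> complex mat" where
  "pencil d J u x z = mat d d (\<lambda>(i, j). (if i = j then x else 0) + (\<Sum>k\<in>J. z k * (u k $ i * cnj (u k $ j))))"

lemma pencil_carrier [simp]: "pencil d J u x z \<in> carrier_mat d d"
  by (simp add: pencil_def)

lemma pencil_dim [simp]: "dim_row (pencil d J u x z) = d" "dim_col (pencil d J u x z) = d"
  by (simp_all add: pencil_def)

section \<open>Inner products and the quadratic form of a pencil\<close>

lemma cscalar_sum:
  assumes "v \<in> carrier_vec d" "w \<in> carrier_vec d"
  shows "v \<bullet>c w = (\<Sum>i<d. v $ i * cnj (w $ i))"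
  using assms by (simp add: scalar_prod_def atLeast0LessThan)

lemma sq_norm_sum: "v \<in> carrier_vec d \<Longrightarrow> sq_norm v = (\<Sum>i<d. (cmod (v $ i))\<^sup>2)"
  by (simp add: euclid_norm_def L2_set_def sum_nonneg)

lemma cscalar_self: "v \<in> carrier_vec d \<Longrightarrow> v \<bullet>c v = of_real (sq_norm v)"
  by (simp add: cscalar_sum sq_norm_sum complex_mult_cnj cmod_power2)

lemma cscalar_flip:
  "v \<in> carrier_vec d \<Longrightarrow> w \<in> carrier_vec d \<Longrightarrow> w \<bullet>c v = cnj (v \<bullet>c w)"
  by (simp add: cscalar_sum[of _ d] mult.commute)

lemma sq_norm_pos:
  assumes v: "v \<in> carrier_vec d" and "v \<noteq> 0\<^sub>v d"
  shows "sq_norm v > 0"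
proof -
  obtain i where i: "i < d" "v $ i \<noteq> 0" using assms by (metis carrier_vecD eq_vecI index_zero_vec)
  then have "0 < (\<Sum>i<d. (cmod (v $ i))\<^sup>2)" by (intro sum_pos2[of _ i]) auto
  then show ?thesis by (simp only: sq_norm_sum[OF v])
qed

lemma cscalar_Cauchy_Schwarz:
  assumes "v \<in> carrier_vec d" "w \<in> carrier_vec d"
  shows "(cmod (v \<bullet>c w))\<^sup>2 \<le> sq_norm v * sq_norm w"
proof -
  have "cmod (v \<bullet>c w) \<le> (\<Sum>i<d. cmod (v $ i) * cmod (w $ i))"
    unfolding cscalar_sum[OF assms] by (rule order_trans[OF norm_sum]) (simp add: norm_mult)
  also have "\<dots> \<le> euclid_norm v * euclid_norm w"
    using L2_set_mult_ineq[of "\<lambda>i. cmod (v $ i)" "\<lambda>i. cmod (w $ i)" "{..<d}"] assms by (simp add: euclid_norm_def)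
  finally show ?thesis by (metis norm_ge_zero power_mono power_mult_distrib)
qed

lemma pencil_mult_index:
  assumes u: "u ` J \<subseteq> carrier_vec d" and v: "v \<in> carrier_vec d" and i: "i < d"
  shows "(pencil d J u x z *\<^sub>v v) $ i = x * v $ i + (\<Sum>k\<in>J. z k * (v \<bullet>c u k) * u k $ i)"
proof -
  have "(pencil d J u x z *\<^sub>v v) $ i
      = (\<Sum>j<d. ((if i = j then x else 0) + (\<Sum>k\<in>J. z k * (u k $ i * cnj (u k $ j)))) * v $ j)"
    using v i by (simp add: pencil_def scalar_prod_def atLeast0LessThan)
  also have "\<dots> = (\<Sum>j<d. if i = j then x * v $ j else 0) + (\<Sum>j<d. \<Sum>k\<in>J. z k * (v $ j * cnj (u k $ j)) * u k $ i)"
    unfolding sum.distrib[symmetric]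
    by (intro sum.cong) (auto simp: algebra_simps sum_distrib_left)
  also have "(\<Sum>j<d. \<Sum>k\<in>J. z k * (v $ j * cnj (u k $ j)) * u k $ i) = (\<Sum>k\<in>J. z k * (v \<bullet>c u k) * u k $ i)"
    using u v by (subst sum.swap) (intro sum.cong, auto simp: cscalar_sum[of _ d] sum_distrib_left sum_distrib_right image_subset_iff)
  finally show ?thesis using i by simp
qed

lemma pencil_form:
  assumes u: "u ` J \<subseteq> carrier_vec d" and v: "v \<in> carrier_vec d" and w: "w \<in> carrier_vec d"
  shows "(pencil d J u x z *\<^sub>v v) \<bullet>c w = x * (v \<bullet>c w) + (\<Sum>k\<in>J. z k * ((v \<bullet>c u k) * cnj (w \<bullet>c u k)))"
proof -
  have "(pencil d J u x z *\<^sub>v v) \<bullet>c w = (\<Sum>i<d. (x * v $ i + (\<Sum>k\<in>J. z k * (v \<bullet>c u k) * u k $ i)) * cnj (w $ i))"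
    using w by (subst cscalar_sum[of _ d]) (auto simp: pencil_mult_index[OF u v] simp del: index_mult_mat_vec intro!: mult_mat_vec_carrier[of _ d d] v)
  also have "\<dots> = x * (\<Sum>i<d. v $ i * cnj (w $ i)) + (\<Sum>i<d. \<Sum>k\<in>J. z k * (v \<bullet>c u k) * (u k $ i * cnj (w $ i)))"
    by (simp add: algebra_simps sum.distrib sum_distrib_left)
  also have "(\<Sum>i<d. \<Sum>k\<in>J. z k * (v \<bullet>c u k) * (u k $ i * cnj (w $ i))) = (\<Sum>k\<in>J. z k * ((v \<bullet>c u k) * cnj (w \<bullet>c u k)))"
    using u w by (subst sum.swap) (intro sum.cong, auto simp: cscalar_sum[of _ d] sum_distrib_left ac_simps image_subset_iff)
  finally show ?thesis using v w by (simp add: cscalar_sum)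
qed

lemma pencil_form_self:
  assumes u: "u ` J \<subseteq> carrier_vec d" and v: "v \<in> carrier_vec d"
  shows "(pencil d J u x z *\<^sub>v v) \<bullet>c v = x * of_real (sq_norm v) + (\<Sum>k\<in>J. z k * of_real ((cmod (v \<bullet>c u k))\<^sup>2))"
  unfolding pencil_form[OF u v v] cscalar_self[OF v] by (simp add: complex_norm_square del: of_real_power)

text \<open>A kernel vector makes the quadratic form vanish. Complex coefficients are allowed since
  the form is kept away from 0 through its imaginary part for stability, and through positivity at
  real points.\<close>

lemma det_pencil_nonzero:
  assumes u: "u ` J \<subseteq> carrier_vec d"
    and pos: "\<And>v. v \<in> carrier_vec d \<Longrightarrow> v \<noteq> 0\<^sub>v d \<Longrightarrow>
      x * of_real (sq_norm v) + (\<Sum>k\<in>J. z k * of_real ((cmod (v \<bullet>c u k))\<^sup>2)) \<noteq> 0"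
  shows "det (pencil d J u x z) \<noteq> 0"
proof
  assume "det (pencil d J u x z) = 0"
  then obtain v where v: "v \<in> carrier_vec d" "v \<noteq> 0\<^sub>v d" "pencil d J u x z *\<^sub>v v = 0\<^sub>v d"
    using det_0_iff_vec_prod_zero_field[OF pencil_carrier] by blast
  then show False using pencil_form_self[OF u v(1), of x z] pos[OF v(1,2)] by simp
qed

lemma pencil_char_poly:
  "det (pencil d J u x z) = poly (char_poly (pencil d J u 0 (\<lambda>k. - z k))) x"
proof -
  have "pencil d J u x z = - char_matrix (pencil d J u 0 (\<lambda>k. - z k)) x"
    by (rule eq_matI) (auto simp: char_matrix_def pencil_def sum_negf)
  then show ?thesis using char_poly_matrix[OF pencil_carrier, of d J u 0 "\<lambda>k. - z k" x] by simp
qed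

lemma det_cnj: "det (map_mat cnj A) = cnj (det A)"
proof -
  interpret cnj: comm_ring_hom cnj by unfold_locales auto
  show ?thesis by simp
qed

text \<open>Conjugating the entries of u u^* transposes it, which the determinant does not
  see.\<close>

lemma det_pencil_cnj: "det (pencil d J u (cnj x) (\<lambda>k. cnj (z k))) = cnj (det (pencil d J u x z))"
proof -
  have "pencil d J u (cnj x) (\<lambda>k. cnj (z k)) = (map_mat cnj (pencil d J u x z))\<^sup>T"
    by (rule eq_matI) (auto simp: pencil_def ac_simps)
  then show ?thesis using det_transpose[of "map_mat cnj (pencil d J u x z)" d] det_cnj[of "pencil d J u x z"] by simp
qed

text \<open>
  Bordering \<open>A\<close> by the column \<open>a\<close> and the row \<open>-w b\<close> gives a matrix in which \<open>w\<close> occurs in the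
  first row only; eliminating that row turns \<open>A\<close> into \<open>A + w a b\<^sup>T\<close>.
\<close>

lemma det_rank_one_affine:
  fixes A :: "complex mat"
  assumes A: "A \<in> carrier_mat d d"
  shows "\<exists>c. \<forall>w. det (mat d d (\<lambda>(i, j). A $$ (i, j) + w * (a i * b j))) = det A + w * c"
proof -
  define N where "N w = mat (Suc d) (Suc d) (\<lambda>(i, j). if i = 0 then (if j = 0 then 1 else - w * b (j - 1))
    else if j = 0 then a (i - 1) else A $$ (i - 1, j - 1))" for w
  define E where "E w = mat (Suc d) (Suc d) (\<lambda>(i, j). if i = j then 1 else if i = 0 then w * b (j - 1) else 0)" for w
  define B where "B w = mat d d (\<lambda>(i, j). A $$ (i, j) + w * (a i * b j))" for w
  have N: "N w \<in> carrier_mat (Suc d) (Suc d)" and E: "E w \<in> carrier_mat (Suc d) (Suc d)" for w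
    by (auto simp: N_def E_def)
  have "upper_triangular (E w)" for w by (auto simp: E_def)
  moreover have "diag_mat (E w) = replicate (Suc d) 1" for w
    by (rule nth_equalityI) (auto simp: diag_mat_def E_def simp del: upt_Suc replicate_Suc)
  ultimately have detE: "det (E w) = 1" for w
    using det_upper_triangular[OF _ E] by (simp del: replicate_Suc)
  define cof where "cof j = cofactor (N 0) 0 j" for j
  have cof: "cofactor (N w) 0 j = cof j" for w j
  proof -
    have "mat_delete (N w) 0 j = mat_delete (N 0) 0 j"
      by (rule eq_matI) (auto simp: mat_delete_def N_def)
    then show ?thesis by (simp add: cof_def cofactor_def)
  qed
  have detN: "det (N w) = cof 0 + w * (\<Sum>j<d. - b j * cof (Suc j))" for w
  proof -
    have "det (N w) = (\<Sum>j<Suc d. N w $$ (0, j) * cof j)"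
      using laplace_expansion_row[OF N, of 0 w] by (simp add: cof)
    also have "\<dots> = cof 0 + (\<Sum>j<d. - w * b j * cof (Suc j))"
      unfolding sum.lessThan_Suc_shift by (simp add: N_def)
    finally show ?thesis by (simp add: sum_distrib_left algebra_simps)
  qed
  have detB: "det (B w) = det (N w)" for w
  proof -
    define P where "P = N w * E w"
    have P: "P \<in> carrier_mat (Suc d) (Suc d)" unfolding P_def by (rule mult_carrier_mat[OF N E])
    have entry: "P $$ (i, j) = N w $$ (i, 0) * E w $$ (0, j) + (\<Sum>k<d. N w $$ (i, Suc k) * E w $$ (Suc k, j))"
      if "i < Suc d" "j < Suc d" for i j
    proof -
      have "P $$ (i, j) = (\<Sum>k<Suc d. N w $$ (i, k) * E w $$ (k, j))"
        using that N[of w] E[of w] by (simp add: P_def scalar_prod_def atLeast0LessThan del: sum.lessThan_Suc)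
      then show ?thesis by (simp only: sum.lessThan_Suc_shift)
    qed
    have E0: "E w $$ (0, 0) = 1" "\<And>k. k < d \<Longrightarrow> E w $$ (Suc k, 0) = 0" "\<And>j. j < d \<Longrightarrow> E w $$ (0, Suc j) = w * b j"
      "\<And>k j. k < d \<Longrightarrow> j < d \<Longrightarrow> E w $$ (Suc k, Suc j) = (if k = j then 1 else 0)"
      by (auto simp: E_def)
    have N0: "N w $$ (0, 0) = 1" "\<And>k. k < d \<Longrightarrow> N w $$ (0, Suc k) = - w * b k" "\<And>i. i < d \<Longrightarrow> N w $$ (Suc i, 0) = a i"
      "\<And>i k. i < d \<Longrightarrow> k < d \<Longrightarrow> N w $$ (Suc i, Suc k) = A $$ (i, k)"
      by (auto simp: N_def)
    have delta: "(\<Sum>k<d. g k * (if k = j then 1 else 0)) = g j" if "j < d" for g :: "nat \<Rightarrow> complex" and j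
    proof -
      have "(\<Sum>k<d. g k * (if k = j then 1 else 0)) = (\<Sum>k<d. if k = j then g j else 0)"
        by (intro sum.cong) auto
      then show ?thesis using that by simp
    qed
    have P0: "P $$ (0, 0) = 1" using entry[of 0 0] by (simp add: E0 N0)
    have P1: "P $$ (0, Suc j) = 0" if "j < d" for j
      using entry[of 0 "Suc j"] that by (simp add: E0 N0 sum_negf delta)
    have P2: "P $$ (Suc i, Suc j) = A $$ (i, j) + w * (a i * b j)" if "i < d" "j < d" for i j
      using entry[of "Suc i" "Suc j"] that by (simp add: E0 N0 delta)
    have "mat_delete P 0 0 = B w"
      by (rule eq_matI) (use P in \<open>auto simp: mat_delete_def B_def P2\<close>)
    then have "cofactor P 0 0 = det (B w)" by (simp add: cofactor_def)
    moreover have "det P = (\<Sum>j<Suc d. P $$ (0, j) * cofactor P 0 j)"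
      by (rule laplace_expansion_row[OF P]) simp
    then have "det P = cofactor P 0 0"
      unfolding sum.lessThan_Suc_shift by (simp add: P0 P1)
    moreover have "det P = det (N w)" unfolding P_def using det_mult[OF N E] detE by simp
    ultimately show ?thesis by simp
  qed
  have "B 0 = A" using A by (intro eq_matI) (auto simp: B_def)
  then have "det A = cof 0" using detB[of 0] detN[of 0] by simp
  then have "\<forall>w. det (B w) = det A + w * (\<Sum>j<d. - b j * cof (Suc j))"
    using detB detN by simp
  then show ?thesis unfolding B_def by blast
qed

text \<open>The imaginary part of the form at v is Im x times the squared norm of v plus a
  nonnegative combination of the Im z_k, hence positive. Affinity in each coefficient is the
  rank-one update of a determinant.\<close>

lemma stable_det_pencil:
  fixes u :: "'i \<Rightarrow> complex vec"
  assumes J: "finite J" and u: "u ` J \<subseteq> carrier_vec d"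
  shows "stable d (\<lambda>x z. det (pencil d J u x z))"
  unfolding stable_def
proof (intro conjI allI impI)
  show "multiaffine (\<lambda>x z. det (pencil d J u x z))"
    unfolding multiaffine_def
  proof (intro allI)
    fix x and z :: "'i \<Rightarrow> complex" and a w
    show "det (pencil d J u x (z(a := w))) = det (pencil d J u x z) + (w - z a) * pd a (\<lambda>x z. det (pencil d J u x z)) x z"
    proof (cases "a \<in> J")
      case True
      obtain c where c: "\<And>w. det (mat d d (\<lambda>(i, j). pencil d J u x z $$ (i, j) + w * (u a $ i * cnj (u a $ j))))
          = det (pencil d J u x z) + w * c"
        using det_rank_one_affine[OF pencil_carrier, of d J u x z "\<lambda>i. u a $ i" "\<lambda>j. cnj (u a $ j)"] by blast
      have "(\<Sum>k\<in>J. (z(a := w)) k * (u k $ i * cnj (u k $ j)))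
          = (\<Sum>k\<in>J. z k * (u k $ i * cnj (u k $ j))) + (w - z a) * (u a $ i * cnj (u a $ j))" for w i j
        using J True by (simp add: sum.remove algebra_simps)
      then have "pencil d J u x (z(a := w)) = mat d d (\<lambda>(i, j). pencil d J u x z $$ (i, j) + (w - z a) * (u a $ i * cnj (u a $ j)))" for w
        by (intro eq_matI) (simp_all add: pencil_def)
      then have upd: "det (pencil d J u x (z(a := w))) = det (pencil d J u x z) + (w - z a) * c" for w
        using c by simp
      then have "pd a (\<lambda>x z. det (pencil d J u x z)) x z = c" unfolding pd_def by simp
      then show ?thesis using upd by simp
    next
      case False
      then have "pencil d J u x (z(a := w)) = pencil d J u x z" for w
        unfolding pencil_def by (auto intro!: sum.cong cong_mat)
      then show ?thesis by (simp add: pd_def)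
    qed
  qed
next
  fix z :: "'i \<Rightarrow> complex"
  show "\<exists>q. degree q = d \<and> lead_coeff q = 1 \<and> (\<forall>x. det (pencil d J u x z) = poly q x)"
    using degree_monic_char_poly[OF pencil_carrier, of d J u 0 "\<lambda>k. - z k"] pencil_char_poly
    by (intro exI[of _ "char_poly (pencil d J u 0 (\<lambda>k. - z k))"]) auto
next
  fix x and z :: "'i \<Rightarrow> complex"
  show "det (pencil d J u (cnj x) (\<lambda>a. cnj (z a))) = cnj (det (pencil d J u x z))"
    by (rule det_pencil_cnj)
next
  fix x and z :: "'i \<Rightarrow> complex" assume x: "0 < Im x" and z: "\<forall>a. 0 \<le> Im (z a)"
  show "det (pencil d J u x z) \<noteq> 0"
  proof (rule det_pencil_nonzero[OF u])
    fix v :: "complex vec" assume v: "v \<in> carrier_vec d" "v \<noteq> 0\<^sub>v d"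
    have "Im (x * of_real (sq_norm v) + (\<Sum>k\<in>J. z k * of_real ((cmod (v \<bullet>c u k))\<^sup>2)))
        = Im x * sq_norm v + (\<Sum>k\<in>J. Im (z k) * (cmod (v \<bullet>c u k))\<^sup>2)"
      by (simp del: of_real_power)
    moreover have "\<dots> > 0"
      using x z sq_norm_pos[OF v] by (intro add_pos_nonneg sum_nonneg mult_nonneg_nonneg mult_pos_pos) auto
    ultimately show "x * of_real (sq_norm v) + (\<Sum>k\<in>J. z k * of_real ((cmod (v \<bullet>c u k))\<^sup>2)) \<noteq> 0"
      by (metis less_irrefl zero_complex.sel(2))
  qed
qed

text \<open>The Boolean tag keeps the variables of the factors disjoint; with shared variables the
  product would in general be quadratic in each of them.\<close>

lemma stable_product:
  fixes f g :: "'a stable_fun"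
  assumes f: "stable m f" and g: "stable n g"
  shows "stable (m + n) (\<lambda>x z. f x (\<lambda>k. z (k, True)) * g x (\<lambda>k. z (k, False)))" (is "stable _ ?h")
  unfolding stable_def
proof (intro conjI allI impI)
  show "multiaffine ?h"
    unfolding multiaffine_def
  proof (intro allI)
    fix x :: complex and z :: "'a \<times> bool \<Rightarrow> complex" and a :: "'a \<times> bool" and w
    obtain k s where a: "a = (k, s)" by fastforce
    have upd: "(\<lambda>k'. (z((k, s) := w)) (k', s')) = (if s' = s then (\<lambda>k'. z (k', s'))(k := w) else (\<lambda>k'. z (k', s')))" for w s'
      by auto
    note mf = multiaffineD[OF stable_multiaffine[OF f], of x "\<lambda>k. z (k, True)" k w]
    note mg = multiaffineD[OF stable_multiaffine[OF g], of x "\<lambda>k. z (k, False)" k w]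
    show "?h x (z(a := w)) = ?h x z + (w - z a) * pd a ?h x z"
      unfolding a pd_def upd
      by (cases s) (simp_all add: mf mg, simp_all add: pd_def algebra_simps)
  qed
next
  fix z :: "'a \<times> bool \<Rightarrow> complex"
  obtain q where q: "degree q = m" "lead_coeff q = 1" "\<And>x. f x (\<lambda>k. z (k, True)) = poly q x"
    using stable_monic[OF f, of "\<lambda>k. z (k, True)"] by blast
  obtain r where r: "degree r = n" "lead_coeff r = 1" "\<And>x. g x (\<lambda>k. z (k, False)) = poly r x"
    using stable_monic[OF g, of "\<lambda>k. z (k, False)"] by blast
  have "q \<noteq> 0" "r \<noteq> 0" using q r by auto
  then have "degree (q * r) = m + n" using q r by (simp add: degree_mult_eq)
  moreover have "lead_coeff (q * r) = 1" using q(2) r(2) by (simp only: lead_coeff_mult mult_1)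
  ultimately show "\<exists>q. degree q = m + n \<and> lead_coeff q = 1 \<and> (\<forall>x. ?h x z = poly q x)"
    using q(3) r(3) by (intro exI[of _ "q * r"]) auto
next
  fix x and z :: "'a \<times> bool \<Rightarrow> complex"
  show "?h (cnj x) (\<lambda>a. cnj (z a)) = cnj (?h x z)"
    using stable_cnj[OF f, of x "\<lambda>k. z (k, True)"] stable_cnj[OF g, of x "\<lambda>k. z (k, False)"] by simp
next
  fix x and z :: "'a \<times> bool \<Rightarrow> complex" assume "0 < Im x" "\<forall>a. 0 \<le> Im (z a)"
  then show "?h x z \<noteq> 0"
    using stable_nonzero[OF f, of x "\<lambda>k. z (k, True)"] stable_nonzero[OF g, of x "\<lambda>k. z (k, False)"] by simp
qed

section \<open>Discrepancy\<close>

text \<open>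
  If the form took a value \<open>q < 0\<close> at \<open>y\<close>, then adding \<open>-1/q\<close> times the rank-one matrix of
  \<open>pencil d J u \<eta> z *\<^sub>v y\<close> would make \<open>y\<close> a kernel vector, although moving in a rank-one direction
  cannot lose positivity of the determinant.
\<close>

lemma form_nonneg_of_det_nonzero:
  fixes u :: "'i \<Rightarrow> complex vec" and z :: "'i \<Rightarrow> real"
  assumes J: "finite J" and k0: "k0 \<notin> J" and u: "u ` J \<subseteq> carrier_vec d"
    and nz: "\<And>x. x \<ge> \<eta> \<Longrightarrow> det (pencil d J u (of_real x) (\<lambda>k. of_real (z k))) \<noteq> 0"
    and y: "y \<in> carrier_vec d"
  shows "0 \<le> \<eta> * sq_norm y + (\<Sum>k\<in>J. z k * (cmod (y \<bullet>c u k))\<^sup>2)"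
proof (rule ccontr)
  define q where "q = \<eta> * sq_norm y + (\<Sum>k\<in>J. z k * (cmod (y \<bullet>c u k))\<^sup>2)"
  assume "\<not> 0 \<le> \<eta> * sq_norm y + (\<Sum>k\<in>J. z k * (cmod (y \<bullet>c u k))\<^sup>2)"
  then have q: "q < 0" by (simp add: q_def)
  define M where "M = pencil d J u (of_real \<eta>) (\<lambda>k. complex_of_real (z k))"
  define w where "w = M *\<^sub>v y"
  have w: "w \<in> carrier_vec d" unfolding w_def M_def using y by (intro mult_mat_vec_carrier[OF pencil_carrier])
  have wy: "w \<bullet>c y = of_real q"
    unfolding w_def M_def pencil_form_self[OF u y] q_def by simp
  then have yw: "y \<bullet>c w = of_real q" using cscalar_flip[OF w y] by simp
  \<comment> \<open>The fresh index \<open>k0\<close> carries w with coefficient 0, which leaves the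
    pencil unchanged; this coefficient is then raised to -1 / q > 0.\<close>
  define u' J' z' where "u' = u(k0 := w)" and "J' = insert k0 J" and "z' = z(k0 := 0)"
  have u': "u' ` J' \<subseteq> carrier_vec d" using u w k0 by (auto simp: u'_def J'_def)
  have sum': "(\<Sum>k\<in>J'. (complex_of_real ((z'(k0 := s)) k)) * h (u' k)) = of_real s * h w + (\<Sum>k\<in>J. of_real (z k) * h (u k))"
    for s and h :: "complex vec \<Rightarrow> complex"
  proof -
    have "(\<Sum>k\<in>J. complex_of_real ((z'(k0 := s)) k) * h (u' k)) = (\<Sum>k\<in>J. of_real (z k) * h (u k))"
      using k0 by (intro sum.cong) (auto simp: z'_def u'_def)
    then show ?thesis using J k0 by (simp add: J'_def u'_def)
  qed
  have z': "z'(k0 := 0) = z'" by (auto simp: z'_def)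
  have "pencil d J' u' x (\<lambda>k. of_real (z' k)) = pencil d J u x (\<lambda>k. of_real (z k))" for x
    unfolding pencil_def using sum'[of 0] unfolding z' by (intro cong_mat) auto
  then have "above (\<lambda>x z. det (pencil d J' u' x z)) \<eta> z'"
    using nz J u' by (intro aboveI[OF stable_det_pencil]) (auto simp: J'_def)
  then have "above (\<lambda>x z. det (pencil d J' u' x z)) \<eta> (z'(k0 := - 1 / q))"
    using J u' q by (intro above_upd[OF stable_det_pencil]) (auto simp: J'_def z'_def divide_nonneg_neg)
  then have "det (pencil d J' u' (of_real \<eta>) (\<lambda>k. of_real ((z'(k0 := - 1 / q)) k))) \<noteq> 0"
    unfolding above_def rval_def by force
  moreover have "pencil d J' u' (of_real \<eta>) (\<lambda>k. of_real ((z'(k0 := - 1 / q)) k)) *\<^sub>v y = 0\<^sub>v d"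
  proof (rule eq_vecI)
    fix i assume "i < dim_vec (0\<^sub>v d :: complex vec)"
    then have i: "i < d" by simp
    have wi: "w $ i = of_real \<eta> * y $ i + (\<Sum>k\<in>J. of_real (z k) * (y \<bullet>c u k) * u k $ i)"
      unfolding w_def M_def by (rule pencil_mult_index[OF u y i])
    \<comment> \<open>As y has inner product q with w, the added term is (-1 / q) q w = -w and
      cancels M y = w.\<close>
    have "(pencil d J' u' (of_real \<eta>) (\<lambda>k. of_real ((z'(k0 := - 1 / q)) k)) *\<^sub>v y) $ i
        = of_real (- 1 / q) * ((y \<bullet>c w) * w $ i) + w $ i"
      unfolding pencil_mult_index[OF u' y i] mult.assoc
      using sum'[of "- 1 / q" "\<lambda>v. (y \<bullet>c v) * v $ i"] wi by (simp add: mult.assoc)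
    also have "\<dots> = 0" using q by (simp add: yw)
    finally show "(pencil d J' u' (of_real \<eta>) (\<lambda>k. of_real ((z'(k0 := - 1 / q)) k)) *\<^sub>v y) $ i = 0\<^sub>v d $ i"
      using i by simp
  qed (simp add: pencil_def)
  moreover have "y \<noteq> 0\<^sub>v d"
  proof
    assume "y = 0\<^sub>v d"
    then have "w \<bullet>c y = 0" using w by simp
    then show False using wy q by simp
  qed
  ultimately show False using det_0_iff_vec_prod_zero_field[OF pencil_carrier] y by blast
qed

text \<open>
  The starting point \<open>-\<surd>\<epsilon> c\<close> has barriers at most \<open>\<surd>\<epsilon> / (1 + \<surd>\<epsilon>) = 1 - 1 / \<delta>\<close> for \<open>\<delta> = 1 + \<surd>\<epsilon>\<close>, and
  the steps of length \<open>\<delta>\<close> end in \<open>c\<close>.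
\<close>

lemma rank_one_discrepancy:
  fixes u :: "nat \<Rightarrow> complex vec"
  assumes J: "finite J" and u: "u ` J \<subseteq> carrier_vec d" and eps: "\<epsilon> > 0"
    and le1: "\<And>v. v \<in> carrier_vec d \<Longrightarrow> (\<Sum>k\<in>J. (cmod (v \<bullet>c u k))\<^sup>2) \<le> sq_norm v"
    and le_eps: "\<And>k. k \<in> J \<Longrightarrow> sq_norm (u k) \<le> \<epsilon>"
    and t: "\<And>k. k \<in> J \<Longrightarrow> 0 \<le> t k \<and> t k \<le> 1"
  shows "\<exists>S\<subseteq>J. \<forall>v\<in>carrier_vec d.
    \<bar>\<Sum>k\<in>J. (of_bool (k \<in> S) - t k) * (cmod (v \<bullet>c u k))\<^sup>2\<bar> \<le> (2 * sqrt \<epsilon> + \<epsilon>) * sq_norm v"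
proof -
  define s where "s = sqrt \<epsilon>"
  have s: "s > 0" "s * s = \<epsilon>" using eps by (auto simp: s_def)
  define \<eta> where "\<eta> = 2 * s + \<epsilon>"
  define \<delta> where "\<delta> = 1 + s"
  define F :: "(nat \<times> bool) stable_fun"
    where "F = (\<lambda>x z. det (pencil d J u x (\<lambda>k. z (k, True))) * det (pencil d J u x (\<lambda>k. z (k, False))))"
  have st: "stable (d + d) F"
    unfolding F_def by (rule stable_product[OF stable_det_pencil[OF J u] stable_det_pencil[OF J u]])
  define c where "c = (\<lambda>(k, b). if b then t k else 1 - t k)"
  have c: "0 \<le> c (k, b)" "c (k, b) \<le> 1" if "k \<in> J" for k b
    using t[OF that] by (auto simp: c_def)
  have F_nz: "F (of_real x) (\<lambda>a. of_real (z a)) \<noteq> 0"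
    if pos: "\<And>v b. v \<in> carrier_vec d \<Longrightarrow> v \<noteq> 0\<^sub>v d \<Longrightarrow> 0 < x * sq_norm v + (\<Sum>k\<in>J. z (k, b) * (cmod (v \<bullet>c u k))\<^sup>2)"
    for x z
  proof -
    have "det (pencil d J u (of_real x) (\<lambda>k. of_real (z (k, b)))) \<noteq> 0" for b
    proof (rule det_pencil_nonzero[OF u])
      fix v :: "complex vec" assume v: "v \<in> carrier_vec d" "v \<noteq> 0\<^sub>v d"
      have "complex_of_real x * of_real (sq_norm v) + (\<Sum>k\<in>J. of_real (z (k, b)) * of_real ((cmod (v \<bullet>c u k))\<^sup>2))
          = of_real (x * sq_norm v + (\<Sum>k\<in>J. z (k, b) * (cmod (v \<bullet>c u k))\<^sup>2))" by simp
      then show "complex_of_real x * of_real (sq_norm v) + (\<Sum>k\<in>J. of_real (z (k, b)) * of_real ((cmod (v \<bullet>c u k))\<^sup>2)) \<noteq> 0"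
        using pos[OF v, of b] by (simp only: of_real_eq_0_iff)
    qed
    then show ?thesis by (simp add: F_def)
  qed
  define z0 where "z0 a = - s * c a" for a
  have z0_le: "- s * sq_norm v \<le> (\<Sum>k\<in>J. z0 (k, b) * (cmod (v \<bullet>c u k))\<^sup>2)" if v: "v \<in> carrier_vec d" for v b
  proof -
    have "(\<Sum>k\<in>J. c (k, b) * (cmod (v \<bullet>c u k))\<^sup>2) \<le> (\<Sum>k\<in>J. (cmod (v \<bullet>c u k))\<^sup>2)"
      using c by (intro sum_mono mult_left_le_one_le) auto
    also have "\<dots> \<le> sq_norm v" by (rule le1[OF v])
    finally have "s * (\<Sum>k\<in>J. c (k, b) * (cmod (v \<bullet>c u k))\<^sup>2) \<le> s * sq_norm v"
      using s by (intro mult_left_mono) auto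
    then show ?thesis by (simp add: z0_def sum_distrib_left sum_negf mult.assoc)
  qed
  have ab0: "above F \<eta> z0"
  proof (rule aboveI[OF st], rule F_nz)
    fix x b and v :: "complex vec" assume x: "\<eta> \<le> x" and v: "v \<in> carrier_vec d" "v \<noteq> 0\<^sub>v d"
    have "(x - s) * sq_norm v > 0"
      using x s eps sq_norm_pos[OF v] by (intro mult_pos_pos) (auto simp: \<eta>_def)
    then show "0 < x * sq_norm v + (\<Sum>k\<in>J. z0 (k, b) * (cmod (v \<bullet>c u k))\<^sup>2)"
      using z0_le[OF v(1), of b] by (simp add: algebra_simps)
  qed
  have bar: "barrier F (j, b) \<eta> z0 \<le> 1 - 1 / \<delta>" if j: "j \<in> J" for j b
  proof (rule ccontr)
    define \<phi> where "\<phi> = barrier F (j, b) \<eta> z0"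
    assume "\<not> barrier F (j, b) \<eta> z0 \<le> 1 - 1 / \<delta>"
    moreover have del: "1 - 1 / \<delta> = s / (1 + s)" using s by (simp add: \<delta>_def field_simps)
    ultimately have phi: "\<phi> > s / (1 + s)" by (simp add: \<phi>_def)
    moreover have "s / (1 + s) > 0" using s by simp
    ultimately have phi0: "\<phi> > 0" by linarith
    \<comment> \<open>The right side is \<eta> - s, the margin that the form at \<open>z0\<close>
      keeps. The inequality is s < \<phi> (1 + s) multiplied by s.\<close>
    have small: "\<epsilon> / \<phi> < s + \<epsilon>"
    proof -
      have "s < \<phi> * (1 + s)" using phi s by (simp add: field_simps)
      then have "s * s < s * (\<phi> * (1 + s))" using s by (intro mult_strict_left_mono) auto
      then show ?thesis using phi0 s by (simp add: field_simps)
    qed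
    \<comment> \<open>In the coordinate (j, b) the function is affine with relative slope \<phi>, so
      lowering it by 1 / \<phi> reaches a zero; yet by Cauchy-Schwarz the form loses less than its
      margin and stays positive definite.\<close>
    define z1 where "z1 = z0((j, b) := z0 (j, b) - 1 / \<phi>)"
    have "F (of_real \<eta>) (\<lambda>a. of_real (z1 a)) \<noteq> 0"
    proof (rule F_nz)
      fix b' and v :: "complex vec" assume v: "v \<in> carrier_vec d" "v \<noteq> 0\<^sub>v d"
      have sum_eq: "(\<Sum>k\<in>J. z1 (k, b') * (cmod (v \<bullet>c u k))\<^sup>2)
          = (\<Sum>k\<in>J. z0 (k, b') * (cmod (v \<bullet>c u k))\<^sup>2) - of_bool (b' = b) * ((cmod (v \<bullet>c u j))\<^sup>2 / \<phi>)"
      proof -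
        have "(\<Sum>k\<in>J - {j}. z1 (k, b') * (cmod (v \<bullet>c u k))\<^sup>2) = (\<Sum>k\<in>J - {j}. z0 (k, b') * (cmod (v \<bullet>c u k))\<^sup>2)"
          by (intro sum.cong) (auto simp: z1_def)
        then show ?thesis
          using J j by (simp add: sum.remove[of J j] z1_def algebra_simps)
      qed
      have "(cmod (v \<bullet>c u j))\<^sup>2 \<le> sq_norm v * sq_norm (u j)"
        using u j v by (intro cscalar_Cauchy_Schwarz[of _ d]) auto
      also have "\<dots> \<le> sq_norm v * \<epsilon>" using le_eps[OF j] by (intro mult_left_mono) auto
      finally have "(cmod (v \<bullet>c u j))\<^sup>2 / \<phi> \<le> sq_norm v * \<epsilon> / \<phi>" using phi0 by (intro divide_right_mono) auto
      also have "\<dots> = sq_norm v * (\<epsilon> / \<phi>)" by simp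
      also have "\<dots> < sq_norm v * (s + \<epsilon>)" using small sq_norm_pos[OF v] by (intro mult_strict_left_mono)
      finally have "of_bool (b' = b) * ((cmod (v \<bullet>c u j))\<^sup>2 / \<phi>) < sq_norm v * (s + \<epsilon>)"
        using sq_norm_pos[OF v] s eps by auto
      then show "0 < \<eta> * sq_norm v + (\<Sum>k\<in>J. z1 (k, b') * (cmod (v \<bullet>c u k))\<^sup>2)"
        unfolding sum_eq \<eta>_def using z0_le[OF v(1), of b'] by (simp add: algebra_simps)
    qed
    moreover have "rval F \<eta> z1 = 0"
      unfolding z1_def rval_upd_barrier[OF st ab0 order_refl] using phi0 by (simp add: \<phi>_def)
    ultimately show False by (simp add: stable_real[OF st])
  qed
  obtain js where js: "set js = J" "distinct js" using finite_distinct_list[OF J] by blast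
  have "\<delta> > 0" using s by (simp add: \<delta>_def)
  define z2 where "z2 = (\<lambda>(j, b). if j \<in> set js then z0 (j, b) + (if b then t j else 1 - t j) * \<delta> else z0 (j, b))"
  have "above (avgs t js F) \<eta> z2"
    unfolding z2_def using js t bar \<open>\<delta> > 0\<close> by (intro above_avgs[OF st _ _ _ ab0]) auto
  then have "\<exists>\<sigma>. above F \<eta> (\<lambda>(j, b). if j \<in> set js \<and> \<sigma> j = b then z2 (j, b) - 1 else z2 (j, b))"
    using js t by (intro above_choice[OF st]) auto
  then obtain \<sigma> where \<sigma>: "above F \<eta> (\<lambda>(j, b). if j \<in> set js \<and> \<sigma> j = b then z2 (j, b) - 1 else z2 (j, b))" ..
  define z3 where "z3 = (\<lambda>(j, b). if j \<in> set js \<and> \<sigma> j = b then z2 (j, b) - 1 else z2 (j, b))"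
  define S where "S = {k\<in>J. \<sigma> k}"
  have z3: "z3 (k, b) = (if b then t k - of_bool (k \<in> S) else of_bool (k \<in> S) - t k)" if "k \<in> J" for k b
    using that js by (auto simp: z3_def z2_def z0_def c_def S_def \<delta>_def algebra_simps)
  obtain k0 where k0: "k0 \<notin> J" using ex_new_if_finite[OF infinite_UNIV_nat J] by blast
  have "0 \<le> \<eta> * sq_norm v + (\<Sum>k\<in>J. z3 (k, b) * (cmod (v \<bullet>c u k))\<^sup>2)" if v: "v \<in> carrier_vec d" for v b
  proof (rule form_nonneg_of_det_nonzero[OF J k0 u _ v])
    fix x assume "\<eta> \<le> x"
    then have "F (of_real x) (\<lambda>a. of_real (z3 a)) \<noteq> 0"
      using \<sigma> unfolding above_def rval_def z3_def by force
    then show "det (pencil d J u (of_real x) (\<lambda>k. of_real (z3 (k, b)))) \<noteq> 0"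
      by (cases b) (auto simp: F_def)
  qed
  note * = this
  have "\<bar>\<Sum>k\<in>J. (of_bool (k \<in> S) - t k) * (cmod (v \<bullet>c u k))\<^sup>2\<bar> \<le> \<eta> * sq_norm v" if v: "v \<in> carrier_vec d" for v
  proof -
    have "(\<Sum>k\<in>J. z3 (k, False) * (cmod (v \<bullet>c u k))\<^sup>2) = (\<Sum>k\<in>J. (of_bool (k \<in> S) - t k) * (cmod (v \<bullet>c u k))\<^sup>2)"
      by (intro sum.cong) (auto simp: z3)
    moreover have "(\<Sum>k\<in>J. z3 (k, True) * (cmod (v \<bullet>c u k))\<^sup>2) = - (\<Sum>k\<in>J. (of_bool (k \<in> S) - t k) * (cmod (v \<bullet>c u k))\<^sup>2)"
      unfolding sum_negf[symmetric] by (intro sum.cong) (auto simp: z3 algebra_simps)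
    ultimately show ?thesis using *[OF v, of True] *[OF v, of False] by linarith
  qed
  then show ?thesis unfolding \<eta>_def s_def by (intro exI[of _ S]) (auto simp: S_def)
qed

text \<open>Polarization: with w = X v and r = 1 / \<kappa>, the squared norm of w times 4 r is the
  difference of the form at v + r w and at v - r w. The hypothesis and the parallelogram law bound
  it, and this choice of r yields the norm of w at most \<kappa> times that of v.\<close>

lemma op_norm_pencil_le:
  fixes a :: "'i \<Rightarrow> real"
  assumes u: "u ` J \<subseteq> carrier_vec d" and pos: "\<kappa> > 0"
    and form: "\<And>v. v \<in> carrier_vec d \<Longrightarrow> \<bar>\<Sum>k\<in>J. a k * (cmod (v \<bullet>c u k))\<^sup>2\<bar> \<le> \<kappa> * sq_norm v"
  shows "op_norm (pencil d J u 0 (\<lambda>k. of_real (a k))) \<le> \<kappa>"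
proof -
  let ?X = "pencil d J u 0 (\<lambda>k. of_real (a k))"
  define Q where "Q v = (\<Sum>k\<in>J. a k * (cmod (v \<bullet>c u k))\<^sup>2)" for v
  have par: "(cmod (x + of_real r * y))\<^sup>2 - (cmod (x - of_real r * y))\<^sup>2 = 4 * r * Re (x * cnj y)"
    "(cmod (x + of_real r * y))\<^sup>2 + (cmod (x - of_real r * y))\<^sup>2 = 2 * (cmod x)\<^sup>2 + 2 * r\<^sup>2 * (cmod y)\<^sup>2" for x y r
    unfolding cmod_power2 by (simp_all add: power2_eq_square algebra_simps)
  have bound: "euclid_norm (?X *\<^sub>v v) \<le> \<kappa> * euclid_norm v" if v: "v \<in> carrier_vec d" for v
  proof -
    define w where "w = ?X *\<^sub>v v"
    have w: "w \<in> carrier_vec d" unfolding w_def by (rule mult_mat_vec_carrier[OF pencil_carrier v])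
    define r where "r = 1 / \<kappa>"
    define p m where "p = v + of_real r \<cdot>\<^sub>v w" and "m = v - of_real r \<cdot>\<^sub>v w"
    have pm: "p \<in> carrier_vec d" "m \<in> carrier_vec d" using v w by (auto simp: p_def m_def)
    have ip: "p \<bullet>c u k = v \<bullet>c u k + of_real r * (w \<bullet>c u k)" "m \<bullet>c u k = v \<bullet>c u k - of_real r * (w \<bullet>c u k)" if "k \<in> J" for k
    proof -
      have uk: "u k \<in> carrier_vec d" using u that by auto
      show "p \<bullet>c u k = v \<bullet>c u k + of_real r * (w \<bullet>c u k)" "m \<bullet>c u k = v \<bullet>c u k - of_real r * (w \<bullet>c u k)"
        unfolding cscalar_sum[OF v uk] cscalar_sum[OF w uk] cscalar_sum[OF pm(1) uk] cscalar_sum[OF pm(2) uk]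
          sum_distrib_left sum.distrib[symmetric] sum_subtractf[symmetric]
        using v w by (auto intro!: sum.cong simp: p_def m_def algebra_simps)
    qed
    have "complex_of_real (sq_norm w) = (\<Sum>k\<in>J. of_real (a k) * ((v \<bullet>c u k) * cnj (w \<bullet>c u k)))"
      using pencil_form[OF u v w, of 0 "\<lambda>k. of_real (a k)"] cscalar_self[OF w] by (simp add: w_def)
    then have "Re (complex_of_real (sq_norm w)) = (\<Sum>k\<in>J. a k * Re ((v \<bullet>c u k) * cnj (w \<bullet>c u k)))"
      by (simp only: Re_sum) (intro sum.cong, simp_all add: algebra_simps)
    then have sqw: "sq_norm w = (\<Sum>k\<in>J. a k * Re ((v \<bullet>c u k) * cnj (w \<bullet>c u k)))" by (simp only: Re_complex_of_real)
    have "Q p - Q m = (\<Sum>k\<in>J. a k * (4 * r * Re ((v \<bullet>c u k) * cnj (w \<bullet>c u k))))"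
      unfolding Q_def sum_subtractf[symmetric] right_diff_distrib[symmetric] by (intro sum.cong) (simp_all only: ip par)
    also have "\<dots> = 4 * r * sq_norm w" unfolding sqw sum_distrib_left by (intro sum.cong) (simp_all only: ac_simps)
    finally have "4 * r * sq_norm w = Q p - Q m" ..
    also have "\<dots> \<le> \<kappa> * sq_norm p + \<kappa> * sq_norm m"
      using form[OF pm(1)] form[OF pm(2)] unfolding Q_def by linarith
    also have "\<dots> = \<kappa> * (2 * sq_norm v + 2 * r\<^sup>2 * sq_norm w)"
    proof -
      have "sq_norm p + sq_norm m = (\<Sum>i<d. (cmod (v $ i + of_real r * w $ i))\<^sup>2 + (cmod (v $ i - of_real r * w $ i))\<^sup>2)"
        unfolding sq_norm_sum[OF pm(1)] sq_norm_sum[OF pm(2)] sum.distrib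
        using v w by (simp add: p_def m_def)
      also have "\<dots> = 2 * sq_norm v + 2 * r\<^sup>2 * sq_norm w"
        unfolding par sq_norm_sum[OF v] sq_norm_sum[OF w] sum.distrib sum_distrib_left ..
      finally show ?thesis by (simp only: distrib_left[symmetric])
    qed
    finally have "4 * sq_norm w / \<kappa> \<le> 2 * \<kappa> * sq_norm v + 2 * sq_norm w / \<kappa>"
      using pos by (simp add: r_def power2_eq_square algebra_simps)
    then have "sq_norm w \<le> (\<kappa> * euclid_norm v)\<^sup>2"
      using pos by (simp add: field_simps power2_eq_square)
    moreover have "0 \<le> \<kappa> * euclid_norm v" using pos by (simp add: euclid_norm_def L2_set_nonneg)
    ultimately show ?thesis unfolding w_def[symmetric] by (rule power2_le_imp_le)
  qed
  show ?thesis unfolding op_norm_def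
  proof (rule cSUP_least)
    \<comment> \<open>The supremum bound requires a nonempty ball; the zero vector also covers d =
      0.\<close>
    have "euclid_norm (0\<^sub>v d) = 0" by (simp add: euclid_norm_def L2_set_def)
    then show "{v \<in> carrier_vec (dim_col ?X). euclid_norm v \<le> 1} \<noteq> {}"
      by (intro ex_in_conv[THEN iffD1] exI[of _ "0\<^sub>v d"]) (simp add: pencil_def)
  next
    fix v assume "v \<in> {v \<in> carrier_vec (dim_col ?X). euclid_norm v \<le> 1}"
    then have v: "v \<in> carrier_vec d" "euclid_norm v \<le> 1" by (auto simp: pencil_def)
    have "\<kappa> * euclid_norm v \<le> \<kappa>" using v pos by simp
    then show "euclid_norm (?X *\<^sub>v v) \<le> \<kappa>" using bound[OF v(1)] by simp
  qed
qed

lemma mat_sum_rank_one: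
  assumes "finite J" "u ` J \<subseteq> carrier_vec d"
  shows "mat_sum d (\<lambda>k. c k \<cdot>\<^sub>m rank_one (u k)) J = pencil d J u 0 c"
  using assms
proof (induction J rule: finite_induct)
  case empty
  interpret abelian_group "module_mat TYPE(complex) d d" by (rule abelian_group_mat)
  have "finsum (module_mat TYPE(complex) d d) (\<lambda>k. c k \<cdot>\<^sub>m rank_one (u k)) {} = 0\<^sub>m d d"
    by (simp add: module_mat_simps)
  also have "\<dots> = pencil d {} u 0 c" by (rule eq_matI) (auto simp: pencil_def)
  finally show ?case .
next
  case (insert k J)
  interpret abelian_group "module_mat TYPE(complex) d d" by (rule abelian_group_mat)
  have car: "c j \<cdot>\<^sub>m rank_one (u j) \<in> carrier_mat d d" if "j \<in> insert k J" for j
    using insert.prems that by (auto simp: rank_one_def)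
  have "mat_sum d (\<lambda>k. c k \<cdot>\<^sub>m rank_one (u k)) (insert k J)
      = c k \<cdot>\<^sub>m rank_one (u k) + mat_sum d (\<lambda>k. c k \<cdot>\<^sub>m rank_one (u k)) J"
    using finsum_insert[OF insert.hyps(1,2), of "\<lambda>k. c k \<cdot>\<^sub>m rank_one (u k)"] car by (auto simp: module_mat_simps)
  also have "\<dots> = c k \<cdot>\<^sub>m rank_one (u k) + pencil d J u 0 c" using insert by simp
  also have "\<dots> = pencil d (insert k J) u 0 c"
    by (rule eq_matI) (use insert in \<open>auto simp: pencil_def rank_one_def\<close>)
  finally show ?case .
qed

theorem theorem1p4:
  shows "\<exists>C::real. C > 0 \<and>
    (\<forall>(d::nat) (m::nat) (\<epsilon>::real) (u :: nat \<Rightarrow> complex vec) (t :: nat \<Rightarrow> real).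
       \<epsilon> > 0 \<longrightarrow>
       (\<forall>i\<in>{1..m}. u i \<in> carrier_vec d) \<longrightarrow>
       loewner_le (mat_sum d (\<lambda>i. rank_one (u i)) {1..m}) (1\<^sub>m d) \<longrightarrow>
       (\<forall>i\<in>{1..m}. (euclid_norm (u i))\<^sup>2 \<le> \<epsilon>) \<longrightarrow>
       (\<forall>i\<in>{1..m}. 0 \<le> t i \<and> t i \<le> 1) \<longrightarrow>
       (\<exists>S \<subseteq> {1..m}.
          op_norm (mat_sum d (\<lambda>i. rank_one (u i)) S
                   - mat_sum d (\<lambda>i. complex_of_real (t i) \<cdot>\<^sub>m rank_one (u i)) {1..m})
            \<le> C * \<epsilon> powr (1 / 8)))"
proof (intro exI[of _ 3] conjI allI impI)
  fix d m :: nat and \<epsilon> :: real and u :: "nat \<Rightarrow> complex vec" and t :: "nat \<Rightarrow> real"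
  assume eps: "\<epsilon> > 0" and "\<forall>i\<in>{1..m}. u i \<in> carrier_vec d"
    and le: "loewner_le (mat_sum d (\<lambda>i. rank_one (u i)) {1..m}) (1\<^sub>m d)"
    and le_eps: "\<forall>i\<in>{1..m}. sq_norm (u i) \<le> \<epsilon>"
    and t: "\<forall>i\<in>{1..m}. 0 \<le> t i \<and> t i \<le> 1"
  define J where "J = {1..m}"
  have J: "finite J" and u: "u ` J \<subseteq> carrier_vec d"
    using \<open>\<forall>i\<in>{1..m}. u i \<in> carrier_vec d\<close> by (auto simp: J_def)
  have sum1: "mat_sum d (\<lambda>i. rank_one (u i)) S = pencil d S u 0 (\<lambda>_. 1)" if "S \<subseteq> J" for S
  proof -
    have "finite S" "u ` S \<subseteq> carrier_vec d" using that J u finite_subset by auto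
    moreover have "1 \<cdot>\<^sub>m rank_one w = rank_one w" for w by (rule eq_matI) auto
    ultimately show ?thesis using mat_sum_rank_one[of S u d "\<lambda>_. 1"] by simp
  qed
  have diff: "mat_sum d (\<lambda>i. rank_one (u i)) S - mat_sum d (\<lambda>i. complex_of_real (t i) \<cdot>\<^sub>m rank_one (u i)) {1..m}
      = pencil d J u 0 (\<lambda>k. of_real (of_bool (k \<in> S) - t k))" if S: "S \<subseteq> J" for S
  proof -
    have "(\<Sum>k\<in>S. u k $ i * cnj (u k $ j)) = (\<Sum>k\<in>J. complex_of_real (of_bool (k \<in> S)) * (u k $ i * cnj (u k $ j)))" for i j
      using S J by (intro sum.mono_neutral_cong_left) auto
    then show ?thesis
      unfolding sum1[OF S] J_def[symmetric] mat_sum_rank_one[OF J u]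
      by (intro eq_matI) (simp_all add: pencil_def sum_subtractf algebra_simps)
  qed
  have le1: "(\<Sum>k\<in>J. (cmod (v \<bullet>c u k))\<^sup>2) \<le> sq_norm v" if v: "v \<in> carrier_vec d" for v
  proof -
    \<comment> \<open>The Loewner hypothesis becomes a bound on the form of a pencil with x = 1 and
      all coefficients -1.\<close>
    have "1\<^sub>m d - mat_sum d (\<lambda>i. rank_one (u i)) {1..m} = pencil d J u 1 (\<lambda>_. - 1)"
      using sum1[of J] by (intro eq_matI) (auto simp: J_def pencil_def sum_negf)
    then have "0 \<le> (pencil d J u 1 (\<lambda>_. - 1) *\<^sub>v v) \<bullet>c v"
      using le v by (simp add: loewner_le_def pos_semidef_def)
    then have "0 \<le> Re ((pencil d J u 1 (\<lambda>_. - 1) *\<^sub>v v) \<bullet>c v)" by (simp add: less_eq_complex_def)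
    then show ?thesis unfolding pencil_form_self[OF u v] by (simp add: sum_negf del: of_real_power)
  qed
  have "\<exists>S\<subseteq>J. \<exists>\<kappa>>0. \<kappa> \<le> 3 * \<epsilon> powr (1 / 8) \<and>
    (\<forall>v\<in>carrier_vec d. \<bar>\<Sum>k\<in>J. (of_bool (k \<in> S) - t k) * (cmod (v \<bullet>c u k))\<^sup>2\<bar> \<le> \<kappa> * sq_norm v)"
  proof (cases "\<epsilon> \<le> 1")
    case True
    \<comment> \<open>For \<epsilon> \<le> 1 smaller exponents give larger powers; the constant 3 is
      2 + 1, from 2 \<surd>\<epsilon> + \<epsilon>.\<close>
    have "sqrt \<epsilon> \<le> \<epsilon> powr (1 / 8)" "\<epsilon> \<le> \<epsilon> powr (1 / 8)"
      using eps True powr_mono'[of "1 / 8" "1 / 2" \<epsilon>] powr_mono'[of "1 / 8" 1 \<epsilon>] by (simp_all add: powr_half_sqrt)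
    then have "2 * sqrt \<epsilon> + \<epsilon> \<le> 3 * \<epsilon> powr (1 / 8)" by simp
    moreover have "2 * sqrt \<epsilon> + \<epsilon> > 0" using eps by (simp add: add_pos_pos)
    moreover obtain S where "S \<subseteq> J" "\<forall>v\<in>carrier_vec d.
      \<bar>\<Sum>k\<in>J. (of_bool (k \<in> S) - t k) * (cmod (v \<bullet>c u k))\<^sup>2\<bar> \<le> (2 * sqrt \<epsilon> + \<epsilon>) * sq_norm v"
      using rank_one_discrepancy[OF J u eps le1, of t] le_eps t unfolding J_def by blast
    ultimately show ?thesis by blast
  next
    case False
    \<comment> \<open>For large \<epsilon> the empty set suffices: the weighted sum lies between 0
      and the identity.\<close>
    have "1 \<le> \<epsilon> powr (1 / 8)" using False by (simp add: ge_one_powr_ge_zero)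
    moreover have "\<bar>\<Sum>k\<in>J. (of_bool (k \<in> {}) - t k) * (cmod (v \<bullet>c u k))\<^sup>2\<bar> \<le> 1 * sq_norm v" if v: "v \<in> carrier_vec d" for v
    proof -
      have "\<bar>\<Sum>k\<in>J. (of_bool (k \<in> {}) - t k) * (cmod (v \<bullet>c u k))\<^sup>2\<bar> = (\<Sum>k\<in>J. t k * (cmod (v \<bullet>c u k))\<^sup>2)"
        using t by (simp add: sum_negf J_def) (intro abs_of_nonneg sum_nonneg, auto)
      also have "\<dots> \<le> (\<Sum>k\<in>J. (cmod (v \<bullet>c u k))\<^sup>2)"
        using t by (intro sum_mono mult_left_le_one_le) (auto simp: J_def)
      also have "\<dots> \<le> 1 * sq_norm v" using le1[OF v] by simp
      finally show ?thesis .
    qed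
    ultimately show ?thesis by (intro exI[of _ "{}"] conjI exI[of _ 1]) auto
  qed
  then obtain S \<kappa> where S: "S \<subseteq> J" and \<kappa>: "\<kappa> > 0" "\<kappa> \<le> 3 * \<epsilon> powr (1 / 8)"
    and form: "\<And>v. v \<in> carrier_vec d \<Longrightarrow> \<bar>\<Sum>k\<in>J. (of_bool (k \<in> S) - t k) * (cmod (v \<bullet>c u k))\<^sup>2\<bar> \<le> \<kappa> * sq_norm v"
    by blast
  have "op_norm (pencil d J u 0 (\<lambda>k. of_real (of_bool (k \<in> S) - t k))) \<le> 3 * \<epsilon> powr (1 / 8)"
    using op_norm_pencil_le[OF u \<kappa>(1) form] \<kappa>(2) by simp
  then show "\<exists>S\<subseteq>{1..m}. op_norm (mat_sum d (\<lambda>i. rank_one (u i)) S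
      - mat_sum d (\<lambda>i. complex_of_real (t i) \<cdot>\<^sub>m rank_one (u i)) {1..m}) \<le> 3 * \<epsilon> powr (1 / 8)"
    using S diff[OF S] by (intro exI[of _ S]) (simp add: J_def)
qed simp

end
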